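(* Let $\mathcal{G}=(B,\psi,A)$ be a $d$-regular connected undirected tracial quantum graph. The following are equivalent: (1) $\mathcal{G}$ is bipartite; (2) $-d\in\mathrm{spec}(A)$, where if $d=0$ it is additionally required that the multiplicity of $0\in\mathrm{spec}(A)$ is at least two, i.e. $\dim B\ge 2$.
   Context: A quantum set is a pair $(B,\psi)$ where $B$ is a finite-dimensional $C^*$-algebra with multiplication $m:B\otimes B\to B$, and $\psi$ is a faithful state on $B$ that is a $\delta$-form, i.e. $mm^\dagger=\delta^2\,\mathrm{id}_B$ for some $\delta\ge 0$. Here $B$ is regarded as the Hilbert space $L^2(B,\psi)$ with inner product $\langle x|y\rangle=\psi(x^*y)$, $B\otimes B$ carries the inner product from $\psi\otimes\psi$, and $(\cdot)^\dagger$ is the Hilbert space adjoint of operators. For linear maps $S,T:B\to B$, the Schur product is $S\bullet T=\delta^{-2}m(S\otimes T)m^\dagger$ and the involution is $T^*(x)=(T(x^* ))^*$. A quantum graph is a triple $(B,\psi,A)$ with $(B,\psi)$ a quantum set and $A:B\to B$ linear satisfying $A\bullet A=A$. It is real if $A^*=A$; undirected if $A$ is real and $A=A^\dagger$; tracial if $\psi$ is a trace; $d$-regular ($d\in\mathbb{C}$) if $A1_B=d1_B=A^\dagger 1_B$. A graph homomorphism $f^{\mathrm{op}}:(B,\psi,A)\to(B',\psi',A')$ is a unital $*$-homomorphism $f:B'\to B$ with $A'\bullet(f^\dagger Af)=f^\dagger Af$ (Schur product on $(B',\psi')$, $f^\dagger$ the adjoint of $f:L^2(B',\psi')\to L^2(B,\psi)$).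 It is surjective if $f$ is injective. With $\tau(a,b)=(a+b)/2$ on $\mathbb{C}^2$, let $T_2=(\mathbb{C}^2,\tau,\mathrm{id})$ and $K_2=(\mathbb{C}^2,\tau,\begin{pmatrix}0&1\\1&0\end{pmatrix})$. A quantum graph $\mathcal{G}$ is connected if there is no surjective graph homomorphism $\mathcal{G}\to T_2$, and bipartite if there is a surjective graph homomorphism $\mathcal{G}\to K_2$. *)

theory Defs
  imports "HOL-Analysis.Analysis"
begin

section \<open>Complex vector spaces, *-algebras and finite-dimensional C*-algebras\<close>

class scaleC =
  fixes scaleC :: "complex \<Rightarrow> 'a \<Rightarrow> 'a" (infixr "*\<^sub>C" 75)

class complex_vector = scaleC + ab_group_add +
  assumes scaleC_add_right: "a *\<^sub>C (x + y) = a *\<^sub>C x + a *\<^sub>C y"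
    and scaleC_add_left: "(a + b) *\<^sub>C x = a *\<^sub>C x + b *\<^sub>C x"
    and scaleC_scaleC: "a *\<^sub>C (b *\<^sub>C x) = (a * b) *\<^sub>C x"
    and scaleC_one: "1 *\<^sub>C x = x"

global_interpretation complex_vector: vector_space "scaleC :: complex \<Rightarrow> 'a \<Rightarrow> 'a::complex_vector"
  by unfold_locales (simp_all add: scaleC_add_right scaleC_add_left scaleC_scaleC scaleC_one)

abbreviation clinear :: "('a::complex_vector \<Rightarrow> 'b::complex_vector) \<Rightarrow> bool" where
  "clinear \<equiv> Vector_Spaces.linear scaleC scaleC"

abbreviation cdim :: "'a::complex_vector set \<Rightarrow> nat" where
  "cdim \<equiv> vector_space.dim scaleC"

instantiation complex :: complex_vector
begin
definition scaleC_complex :: "complex \<Rightarrow> complex \<Rightarrow> complex" where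
  "scaleC_complex a x = a * x"
instance
  by standard (simp_all add: scaleC_complex_def algebra_simps)
end

class star_algebra = complex_vector + ring_1 +
  fixes star :: "'a \<Rightarrow> 'a" ("(_\<^sup>\<star>)" [1000] 999)
  assumes mult_scaleC_left: "(a *\<^sub>C x) * y = a *\<^sub>C (x * y)"
    and mult_scaleC_right: "x * (a *\<^sub>C y) = a *\<^sub>C (x * y)"
    and star_add: "(x + y)\<^sup>\<star> = x\<^sup>\<star> + y\<^sup>\<star>"
    and star_scaleC: "(a *\<^sub>C x)\<^sup>\<star> = cnj a *\<^sub>C x\<^sup>\<star>"
    and star_mult: "(x * y)\<^sup>\<star> = y\<^sup>\<star> * x\<^sup>\<star>"
    and star_star: "(x\<^sup>\<star>)\<^sup>\<star> = x"

text \<open>Unital C*-algebras; they are nonzero because \<^class>\<open>ring_1\<close> requires \<open>0 \<noteq> 1\<close>, which is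
  no restriction here since the zero algebra carries no state.\<close>

class cstar_algebra = star_algebra + real_normed_algebra_1 + banach +
  assumes scaleR_scaleC: "r *\<^sub>R x = complex_of_real r *\<^sub>C x"
    and norm_scaleC: "norm (a *\<^sub>C x) = cmod a * norm x"
    and norm_star_mult: "norm (x\<^sup>\<star> * x) = (norm x)\<^sup>2"

class fd_cstar_algebra = cstar_algebra +
  assumes finite_dimensional: "\<exists>S. finite S \<and> (\<forall>x. \<exists>c. x = (\<Sum>s\<in>S. c s *\<^sub>C s))"


section \<open>The tensor product\<close>

definition cbilinear ::
  "('a::complex_vector \<Rightarrow> 'b::complex_vector \<Rightarrow> 'c::complex_vector) \<Rightarrow> bool" where
  "cbilinear \<beta> \<longleftrightarrow> (\<forall>x. clinear (\<beta> x)) \<and> (\<forall>y. clinear (\<lambda>x. \<beta> x y))"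

text \<open>Elements of the algebraic tensor product are formal finite sums of pairs. Two of them are
  identified when no bilinear form distinguishes them; over a field this is the usual
  tensor product, see \<open>tensor_eval_cong\<close> below for the universal property.\<close>

definition tensor_eq ::
  "('a::complex_vector \<times> 'b::complex_vector) list \<Rightarrow> ('a \<times> 'b) list \<Rightarrow> bool" where
  "tensor_eq s t \<longleftrightarrow> (\<forall>\<beta> :: 'a \<Rightarrow> 'b \<Rightarrow> complex. cbilinear \<beta> \<longrightarrow>
     (\<Sum>(x, y)\<leftarrow>s. \<beta> x y) = (\<Sum>(x, y)\<leftarrow>t. \<beta> x y))"

quotient_type (overloaded) ('a, 'b) tensor =
  "('a::complex_vector \<times> 'b::complex_vector) list" / tensor_eq
  by (rule equivpI) (auto simp: reflp_def symp_def transp_def tensor_eq_def)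

lemma clinear_iff:
  "clinear f \<longleftrightarrow> (\<forall>x y. f (x + y) = f x + f y) \<and> (\<forall>a x. f (a *\<^sub>C x) = a *\<^sub>C f x)"
  by (simp add: Vector_Spaces.linear_iff complex_vector.vector_space_axioms)

lemma cbilinear_simps:
  assumes "cbilinear \<beta>"
  shows "\<beta> (x + x') y = \<beta> x y + \<beta> x' y" "\<beta> x (y + y') = \<beta> x y + \<beta> x y'"
    "\<beta> (a *\<^sub>C x) y = a *\<^sub>C \<beta> x y" "\<beta> x (a *\<^sub>C y) = a *\<^sub>C \<beta> x y"
  using assms by (auto simp: cbilinear_def clinear_iff)

lemma sum_list_scaleC:
  "(\<Sum>(x, y)\<leftarrow>t. a *\<^sub>C \<beta> x y) = a *\<^sub>C (\<Sum>(x, y)\<leftarrow>t. (\<beta> x y :: 'c::complex_vector))"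
  by (induction t) (auto simp: scaleC_add_right)

lemma clinear_sum_list:
  "clinear f \<Longrightarrow> f (\<Sum>(x, y)\<leftarrow>t. \<beta> x y) = (\<Sum>(x, y)\<leftarrow>t. f (\<beta> x y))"
proof (induction t)
  case Nil
  have "f (0 *\<^sub>C 0) = 0 *\<^sub>C f 0"
    using Nil unfolding clinear_iff by blast
  then show ?case by simp
qed (auto simp: clinear_iff)

lemma sum_list_scale_first:
  fixes \<beta> :: "'a::complex_vector \<Rightarrow> 'b::complex_vector \<Rightarrow> 'c::complex_vector"
  assumes "cbilinear \<beta>"
  shows "(\<Sum>(x, y)\<leftarrow>map (\<lambda>(x, y). (a *\<^sub>C x, y)) u. \<beta> x y) = a *\<^sub>C (\<Sum>(x, y)\<leftarrow>u. \<beta> x y)"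
  by (induction u) (auto simp: cbilinear_simps[OF assms] scaleC_add_right)

lemma tensor_eqI:
  fixes s t :: "('a::complex_vector \<times> 'b::complex_vector) list"
  assumes "\<And>\<beta> :: 'a \<Rightarrow> 'b \<Rightarrow> complex. cbilinear \<beta> \<Longrightarrow>
    (\<Sum>(x, y)\<leftarrow>s. \<beta> x y) = (\<Sum>(x, y)\<leftarrow>t. \<beta> x y)"
  shows "tensor_eq s t"
  using assms by (simp add: tensor_eq_def)

lemma tensor_eqD:
  fixes s t :: "('a::complex_vector \<times> 'b::complex_vector) list"
    and \<beta> :: "'a \<Rightarrow> 'b \<Rightarrow> complex"
  assumes "tensor_eq s t" "cbilinear \<beta>"
  shows "(\<Sum>(x, y)\<leftarrow>s. \<beta> x y) = (\<Sum>(x, y)\<leftarrow>t. \<beta> x y)"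
  using assms by (simp add: tensor_eq_def)

instantiation tensor :: (complex_vector, complex_vector) complex_vector
begin

lift_definition zero_tensor :: "('a, 'b) tensor" is "[]" .

lift_definition plus_tensor :: "('a, 'b) tensor \<Rightarrow> ('a, 'b) tensor \<Rightarrow> ('a, 'b) tensor" is "(@)"
  by (auto simp: tensor_eq_def)

lift_definition scaleC_tensor :: "complex \<Rightarrow> ('a, 'b) tensor \<Rightarrow> ('a, 'b) tensor"
  is "\<lambda>a. map (\<lambda>(x, y). (a *\<^sub>C x, y))"
  by (rule tensor_eqI) (simp only: sum_list_scale_first tensor_eqD)

definition uminus_tensor :: "('a, 'b) tensor \<Rightarrow> ('a, 'b) tensor" where
  "uminus_tensor t = (- 1) *\<^sub>C t"

definition minus_tensor :: "('a, 'b) tensor \<Rightarrow> ('a, 'b) tensor \<Rightarrow> ('a, 'b) tensor" where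
  "minus_tensor s t = s + - t"

instance
proof
  fix a b :: complex and s t u :: "('a, 'b) tensor"
  show "s + t + u = s + (t + u)" by transfer (simp add: tensor_eq_def)
  show "s + t = t + s" by transfer (simp add: tensor_eq_def)
  show "0 + t = t" by transfer (simp add: tensor_eq_def)
  show "- t + t = 0" unfolding uminus_tensor_def
    by transfer (rule tensor_eqI, simp only: map_append sum_list_append sum_list_scale_first,
        simp add: scaleC_complex_def)
  show "s - t = s + - t" by (rule minus_tensor_def)
  show "a *\<^sub>C (s + t) = a *\<^sub>C s + a *\<^sub>C t" by transfer (simp add: tensor_eq_def)
  show "(a + b) *\<^sub>C t = a *\<^sub>C t + b *\<^sub>C t"
    by transfer (rule tensor_eqI, simp only: map_append sum_list_append sum_list_scale_first,
        simp add: scaleC_add_left)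
  show "a *\<^sub>C b *\<^sub>C t = (a * b) *\<^sub>C t"
    by transfer (rule tensor_eqI, simp only: sum_list_scale_first scaleC_scaleC)
  show "1 *\<^sub>C t = t"
    by transfer (simp add: scaleC_one tensor_eq_def)
qed

end

lift_definition tensor_pure :: "'a::complex_vector \<Rightarrow> 'b::complex_vector \<Rightarrow> ('a, 'b) tensor"
  (infixr "\<otimes>\<^sub>t" 72) is "\<lambda>x y. [(x, y)]" .

lemma tensor_eval_cong:
  fixes \<beta> :: "'a::complex_vector \<Rightarrow> 'b::complex_vector \<Rightarrow> 'c::complex_vector"
  assumes st: "tensor_eq s t" and \<beta>: "cbilinear \<beta>"
  shows "(\<Sum>(x, y)\<leftarrow>s. \<beta> x y) = (\<Sum>(x, y)\<leftarrow>t. \<beta> x y)"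
proof (rule ccontr)
  define v where "v = (\<Sum>(x, y)\<leftarrow>s. \<beta> x y) - (\<Sum>(x, y)\<leftarrow>t. \<beta> x y)"
  assume "\<not> ?thesis"
  then have "v \<noteq> 0" by (simp add: v_def)
  interpret P: vector_space_pair "scaleC :: complex \<Rightarrow> 'c \<Rightarrow> 'c"
    "scaleC :: complex \<Rightarrow> complex \<Rightarrow> complex" ..
  have "complex_vector.independent {v}"
    using \<open>v \<noteq> 0\<close> by simp
  from P.linear_independent_extend[OF this, of "\<lambda>_. 1"]
  obtain f :: "'c \<Rightarrow> complex" where f: "clinear f" "f v = 1" by auto
  have "cbilinear (\<lambda>x y. f (\<beta> x y))"
    using f(1) \<beta> by (auto simp: cbilinear_def clinear_iff)
  then have "(\<Sum>(x, y)\<leftarrow>s. f (\<beta> x y)) = (\<Sum>(x, y)\<leftarrow>t. f (\<beta> x y))"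
    using st unfolding tensor_eq_def by blast
  then have "f (\<Sum>(x, y)\<leftarrow>s. \<beta> x y) = f (\<Sum>(x, y)\<leftarrow>t. \<beta> x y)"
    by (simp add: clinear_sum_list[OF f(1)])
  moreover have "(\<Sum>(x, y)\<leftarrow>s. \<beta> x y) = v + (\<Sum>(x, y)\<leftarrow>t. \<beta> x y)"
    by (simp add: v_def)
  ultimately have "f v = 0"
    using f(1) by (simp add: clinear_iff)
  with f(2) show False by simp
qed

text \<open>The linear map on the tensor product induced by a bilinear map; the value for a map that is
  not bilinear is a dummy.\<close>

lift_definition tensor_lift ::
  "('a::complex_vector \<Rightarrow> 'b::complex_vector \<Rightarrow> 'c::complex_vector) \<Rightarrow> ('a, 'b) tensor \<Rightarrow> 'c"
  is "\<lambda>\<beta> t. if cbilinear \<beta> then \<Sum>(x, y)\<leftarrow>t. \<beta> x y else 0"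
  by (auto intro: tensor_eval_cong)

lemma tensor_lift_pure: "cbilinear \<beta> \<Longrightarrow> tensor_lift \<beta> (x \<otimes>\<^sub>t y) = \<beta> x y"
  by transfer simp

lemma clinear_tensor_lift: "clinear (tensor_lift \<beta>)"
  unfolding clinear_iff
proof (intro conjI allI)
  show "tensor_lift \<beta> (s + t) = tensor_lift \<beta> s + tensor_lift \<beta> t" for s t
    by transfer simp
  show "tensor_lift \<beta> (a *\<^sub>C t) = a *\<^sub>C tensor_lift \<beta> t" for a t
    by transfer (simp add: sum_list_scale_first del: map_map)
qed

lemma cbilinear_tensor_pure: "cbilinear (\<otimes>\<^sub>t)"
  unfolding cbilinear_def clinear_iff
proof (intro conjI allI)
  fix x x' :: 'a and y y' :: 'b and a
  show "x \<otimes>\<^sub>t (y + y') = x \<otimes>\<^sub>t y + x \<otimes>\<^sub>t y'"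
    by transfer (auto simp: tensor_eq_def cbilinear_simps)
  show "x \<otimes>\<^sub>t a *\<^sub>C y = a *\<^sub>C (x \<otimes>\<^sub>t y)"
    by transfer (auto simp: tensor_eq_def cbilinear_simps)
  show "(x + x') \<otimes>\<^sub>t y = x \<otimes>\<^sub>t y + x' \<otimes>\<^sub>t y"
    by transfer (auto simp: tensor_eq_def cbilinear_simps)
  show "a *\<^sub>C x \<otimes>\<^sub>t y = a *\<^sub>C (x \<otimes>\<^sub>t y)"
    by transfer (auto simp: tensor_eq_def cbilinear_simps)
qed

lemma tensor_induct [case_names zero add]:
  assumes "P 0" and "\<And>x y t. P t \<Longrightarrow> P (x \<otimes>\<^sub>t y + t)"
  shows "P (t :: ('a::complex_vector, 'b::complex_vector) tensor)"
proof -
  have "P (abs_tensor l)" for l :: "('a \<times> 'b) list"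
  proof (induction l)
    case Nil
    then show ?case using assms(1) by (simp add: zero_tensor_def)
  next
    case (Cons p l)
    then have "P (fst p \<otimes>\<^sub>t snd p + abs_tensor l)" by (rule assms(2))
    then show ?case by (simp add: tensor_pure.abs_eq plus_tensor.abs_eq)
  qed
  then show ?thesis by (metis Quotient3_abs_rep Quotient3_tensor)
qed

lemma clinear_simps:
  assumes "clinear f"
  shows "f (x + y) = f x + f y" "f (a *\<^sub>C x) = a *\<^sub>C f x" "f 0 = 0"
  using assms by (auto simp: clinear_iff) (metis complex_vector.scale_zero_left)

instantiation tensor :: (star_algebra, star_algebra) star_algebra
begin

definition one_tensor :: "('a, 'b) tensor" where
  "one_tensor = 1 \<otimes>\<^sub>t 1"

definition times_tensor :: "('a, 'b) tensor \<Rightarrow> ('a, 'b) tensor \<Rightarrow> ('a, 'b) tensor" where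
  "times_tensor s t = tensor_lift (\<lambda>a b. tensor_lift (\<lambda>c d. (a * c) \<otimes>\<^sub>t (b * d)) t) s"

lift_definition star_tensor :: "('a, 'b) tensor \<Rightarrow> ('a, 'b) tensor"
  is "map (\<lambda>(x, y). (x\<^sup>\<star>, y\<^sup>\<star>))"
proof -
  fix s t :: "('a \<times> 'b) list"
  assume st: "tensor_eq s t"
  show "tensor_eq (map (\<lambda>(x, y). (x\<^sup>\<star>, y\<^sup>\<star>)) s) (map (\<lambda>(x, y). (x\<^sup>\<star>, y\<^sup>\<star>)) t)"
    unfolding tensor_eq_def
  proof (intro allI impI)
    fix \<beta> :: "'a \<Rightarrow> 'b \<Rightarrow> complex"
    assume \<beta>: "cbilinear \<beta>"
    have "cbilinear (\<lambda>x y. cnj (\<beta> (x\<^sup>\<star>) (y\<^sup>\<star>)))"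
      unfolding cbilinear_def clinear_iff
      by (auto simp: star_add star_scaleC cbilinear_simps[OF \<beta>] scaleC_complex_def)
    then have "(\<Sum>(x, y)\<leftarrow>s. cnj (\<beta> (x\<^sup>\<star>) (y\<^sup>\<star>))) = (\<Sum>(x, y)\<leftarrow>t. cnj (\<beta> (x\<^sup>\<star>) (y\<^sup>\<star>)))"
      using st unfolding tensor_eq_def by blast
    moreover have "(\<Sum>(x, y)\<leftarrow>u. cnj (\<beta> (x\<^sup>\<star>) (y\<^sup>\<star>))) =
        cnj (\<Sum>(x, y)\<leftarrow>map (\<lambda>(x, y). (x\<^sup>\<star>, y\<^sup>\<star>)) u. \<beta> x y)" for u
      by (induction u) auto
    ultimately show "(\<Sum>(x, y)\<leftarrow>map (\<lambda>(x, y). (x\<^sup>\<star>, y\<^sup>\<star>)) s. \<beta> x y) =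
        (\<Sum>(x, y)\<leftarrow>map (\<lambda>(x, y). (x\<^sup>\<star>, y\<^sup>\<star>)) t. \<beta> x y)"
      by (metis complex_cnj_cancel_iff)
  qed
qed

lemma cbilinear_times_aux: 
  "cbilinear (\<lambda>c d. ((a::'a) * c) \<otimes>\<^sub>t ((b::'b) * d))"
  unfolding cbilinear_def clinear_iff
  by (auto simp: distrib_left mult_scaleC_right cbilinear_simps[OF cbilinear_tensor_pure])

lemma cbilinear_times_aux2: 
  "cbilinear (\<lambda>(a::'a) (b::'b). tensor_lift (\<lambda>c d. (a * c) \<otimes>\<^sub>t (b * d)) t)"
proof (induction t rule: tensor_induct)
  case zero
  then show ?case
    by (simp add: cbilinear_def clinear_iff clinear_simps[OF clinear_tensor_lift])
next
  case (add x y t)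
  have eq: "tensor_lift (\<lambda>c d. (a * c) \<otimes>\<^sub>t (b * d)) (x \<otimes>\<^sub>t y + t) =
      (a * x) \<otimes>\<^sub>t (b * y) + tensor_lift (\<lambda>c d. (a * c) \<otimes>\<^sub>t (b * d)) t" for a :: 'a and b :: 'b
    by (simp only: clinear_simps[OF clinear_tensor_lift] tensor_lift_pure[OF cbilinear_times_aux])
  from add show ?case
    unfolding cbilinear_def clinear_iff eq
    by (simp add: distrib_right mult_scaleC_left cbilinear_simps[OF cbilinear_tensor_pure]
        scaleC_add_right)
qed

lemma times_tensor_pure [simp]:
  "(a \<otimes>\<^sub>t b) * (c \<otimes>\<^sub>t d) = ((a::'a) * c) \<otimes>\<^sub>t ((b::'b) * d)"
  unfolding times_tensor_def
  by (subst tensor_lift_pure[OF cbilinear_times_aux2]) (rule tensor_lift_pure[OF cbilinear_times_aux])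

lemma times_tensor_bilinear:
  fixes s t u :: "('a, 'b) tensor"
  shows "(s + t) * u = s * u + t * u" "(a *\<^sub>C s) * u = a *\<^sub>C (s * u)" "0 * u = 0"
    "u * (s + t) = u * s + u * t" "u * (a *\<^sub>C s) = a *\<^sub>C (u * s)" "u * 0 = 0"
proof -
  show 1: "(s + t) * u = s * u + t * u" "(a *\<^sub>C s) * u = a *\<^sub>C (s * u)" "0 * u = 0"
    by (simp_all add: times_tensor_def clinear_simps[OF clinear_tensor_lift])
  have pure: "(x \<otimes>\<^sub>t y) * t = tensor_lift (\<lambda>c d. (x * c) \<otimes>\<^sub>t (y * d)) t" 
    for x :: 'a and y :: 'b and t
    by (simp add: times_tensor_def tensor_lift_pure[OF cbilinear_times_aux2])
  have lr: "(s + t) * u = s * u + t * u" for s t u :: "('a, 'b) tensor"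
    by (simp_all add: times_tensor_def clinear_simps[OF clinear_tensor_lift])
  have z: "0 * u = 0" for u :: "('a, 'b) tensor"
    by (simp_all add: times_tensor_def clinear_simps[OF clinear_tensor_lift])
  show "u * (s + t) = u * s + u * t"
    by (induction u rule: tensor_induct)
      (simp_all add: lr z pure clinear_simps[OF clinear_tensor_lift])
  show "u * (a *\<^sub>C s) = a *\<^sub>C (u * s)"
    by (induction u rule: tensor_induct)
      (simp_all add: lr z pure clinear_simps[OF clinear_tensor_lift] scaleC_add_right)
  show "u * 0 = 0"
    by (induction u rule: tensor_induct)
      (simp_all add: lr z pure clinear_simps[OF clinear_tensor_lift])
qed

lemma star_tensor_pure [simp]: "(x \<otimes>\<^sub>t y)\<^sup>\<star> = (x :: 'a)\<^sup>\<star> \<otimes>\<^sub>t (y :: 'b)\<^sup>\<star>"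
  by transfer (simp add: tensor_eq_def)

lemma star_tensor_add: "(s + t)\<^sup>\<star> = s\<^sup>\<star> + (t :: ('a, 'b) tensor)\<^sup>\<star>"
  by transfer (simp add: tensor_eq_def)

lemma star_tensor_zero: "(0 :: ('a, 'b) tensor)\<^sup>\<star> = 0"
  by transfer (simp add: tensor_eq_def)

instance
proof
  fix a :: complex and s t u :: "('a, 'b) tensor"
  note bil = times_tensor_bilinear
  show "(s + t) * u = s * u + t * u" "(a *\<^sub>C s) * t = a *\<^sub>C (s * t)"
    "s * (t + u) = s * t + s * u" "s * (a *\<^sub>C t) = a *\<^sub>C (s * t)"
    by (simp_all add: bil)
  have ass1: "((x \<otimes>\<^sub>t y) * (x' \<otimes>\<^sub>t y')) * u = (x \<otimes>\<^sub>t y) * ((x' \<otimes>\<^sub>t y') * u)"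
    for x x' :: 'a and y y' :: 'b
  proof (induction u rule: tensor_induct)
    case (add x y t)
    then show ?case by (simp only: bil times_tensor_pure mult.assoc)
  qed (simp add: bil)
  have ass2: "((x \<otimes>\<^sub>t y) * t) * u = (x \<otimes>\<^sub>t y) * (t * u)"
    for x :: 'a and y :: 'b
  proof (induction t rule: tensor_induct)
    case (add x y t)
    then show ?case by (simp only: bil ass1)
  qed (simp add: bil)
  show "(s * t) * u = s * (t * u)"
  proof (induction s rule: tensor_induct)
    case (add x y t)
    then show ?case by (simp only: bil ass2)
  qed (simp add: bil)
  show "1 * t = t"
    by (induction t rule: tensor_induct) (simp_all add: bil one_tensor_def)
  show "t * 1 = t"
    by (induction t rule: tensor_induct) (simp_all add: bil one_tensor_def)
  show "(s + t)\<^sup>\<star> = s\<^sup>\<star> + t\<^sup>\<star>"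
    by (rule star_tensor_add)
  have star0: "(0 :: 'c :: star_algebra)\<^sup>\<star> = 0"
    using star_add[of "0 :: 'c" 0] by simp
  have scale_pure: "a *\<^sub>C (x \<otimes>\<^sub>t y) = (a *\<^sub>C x) \<otimes>\<^sub>t y" for a and x :: 'a and y :: 'b
    by (simp add: cbilinear_simps[OF cbilinear_tensor_pure])
  show "(a *\<^sub>C t)\<^sup>\<star> = cnj a *\<^sub>C t\<^sup>\<star>"
    by (induction t rule: tensor_induct)
      (simp_all add: star_tensor_zero star_tensor_add scaleC_add_right scale_pure star_scaleC)
  show "(t\<^sup>\<star>)\<^sup>\<star> = t"
    by (induction t rule: tensor_induct) (simp_all add: star_tensor_zero star_tensor_add star_star)
  have sm: "((x \<otimes>\<^sub>t y) * t)\<^sup>\<star> = t\<^sup>\<star> * (x \<otimes>\<^sub>t y)\<^sup>\<star>" for x :: 'a and y :: 'b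
    by (induction t rule: tensor_induct)
      (simp_all add: star_tensor_zero star_tensor_add bil star_mult)
  show "(s * t)\<^sup>\<star> = t\<^sup>\<star> * s\<^sup>\<star>"
    by (induction s rule: tensor_induct)
      (simp_all only: star_tensor_zero star_tensor_add bil sm)
  show "(0 :: ('a, 'b) tensor) \<noteq> 1"
  proof
    assume eq: "(0 :: ('a, 'b) tensor) = 1"
    interpret A: vector_space_pair "scaleC :: complex \<Rightarrow> 'a \<Rightarrow> 'a"
      "scaleC :: complex \<Rightarrow> complex \<Rightarrow> complex" ..
    interpret B: vector_space_pair "scaleC :: complex \<Rightarrow> 'b \<Rightarrow> 'b"
      "scaleC :: complex \<Rightarrow> complex \<Rightarrow> complex" ..
    have "complex_vector.independent {1 :: 'a}" "complex_vector.independent {1 :: 'b}"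
      by simp_all
    from A.linear_independent_extend[OF this(1), of "\<lambda>_. 1"]
      B.linear_independent_extend[OF this(2), of "\<lambda>_. 1"]
    obtain f :: "'a \<Rightarrow> complex" and g :: "'b \<Rightarrow> complex"
      where fg: "clinear f" "f 1 = 1" "clinear g" "g 1 = 1" by auto
    have "cbilinear (\<lambda>x y. f x * g y)"
      unfolding cbilinear_def clinear_iff
      by (auto simp: clinear_simps[OF fg(1)] clinear_simps[OF fg(3)] scaleC_complex_def
          algebra_simps)
    then have "tensor_lift (\<lambda>x y. f x * g y) 1 = 1"
      by (simp add: one_tensor_def tensor_lift_pure fg)
    then show False
      by (simp flip: eq add: clinear_simps[OF clinear_tensor_lift])
  qed
qed

end

text \<open>\<open>S \<otimes> T\<close> for linear maps, \<open>\<phi> \<otimes> \<psi>\<close> for linear functionals, and the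
  multiplication as a linear map \<open>m\<close> on the tensor square.\<close>

definition tensor_map ::
  "('a::complex_vector \<Rightarrow> 'c::complex_vector) \<Rightarrow> ('b::complex_vector \<Rightarrow> 'd::complex_vector) \<Rightarrow>
    ('a, 'b) tensor \<Rightarrow> ('c, 'd) tensor" where
  "tensor_map S T = tensor_lift (\<lambda>x y. S x \<otimes>\<^sub>t T y)"

definition tensor_functional ::
  "('a::complex_vector \<Rightarrow> complex) \<Rightarrow> ('b::complex_vector \<Rightarrow> complex) \<Rightarrow> ('a, 'b) tensor \<Rightarrow> complex"
  where "tensor_functional \<phi> \<psi> = tensor_lift (\<lambda>x y. \<phi> x * \<psi> y)"

definition mult_map :: "('a::star_algebra, 'a) tensor \<Rightarrow> 'a" where
  "mult_map = tensor_lift (*)"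

lemma tensor_map_pure:
  "clinear S \<Longrightarrow> clinear T \<Longrightarrow> tensor_map S T (x \<otimes>\<^sub>t y) = S x \<otimes>\<^sub>t T y"
  unfolding tensor_map_def
  by (rule tensor_lift_pure)
    (simp add: cbilinear_def clinear_iff cbilinear_simps[OF cbilinear_tensor_pure])

lemma tensor_functional_pure:
  "clinear \<phi> \<Longrightarrow> clinear \<psi> \<Longrightarrow> tensor_functional \<phi> \<psi> (x \<otimes>\<^sub>t y) = \<phi> x * \<psi> y"
  unfolding tensor_functional_def
  by (rule tensor_lift_pure)
    (simp add: cbilinear_def clinear_iff scaleC_complex_def algebra_simps)

lemma mult_map_pure: "mult_map (x \<otimes>\<^sub>t y) = x * y"
  unfolding mult_map_def
  by (rule tensor_lift_pure)
    (simp add: cbilinear_def clinear_iff distrib_left distrib_right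
      mult_scaleC_left mult_scaleC_right)


section \<open>Quantum sets\<close>

definition gns_inner :: "('a::star_algebra \<Rightarrow> complex) \<Rightarrow> 'a \<Rightarrow> 'a \<Rightarrow> complex" where
  "gns_inner \<psi> x y = \<psi> (x\<^sup>\<star> * y)"

text \<open>The adjoint of \<open>T : L\<^sup>2(\<phi>) \<rightarrow> L\<^sup>2(\<psi>)\<close>. It exists and is unique for linear \<open>T\<close> when
  the algebras are finite-dimensional and the functionals are faithful states.\<close>

definition adj ::
  "('a::star_algebra \<Rightarrow> complex) \<Rightarrow> ('b::star_algebra \<Rightarrow> complex) \<Rightarrow> ('a \<Rightarrow> 'b) \<Rightarrow> 'b \<Rightarrow> 'a" where
  "adj \<phi> \<psi> T = (THE S. \<forall>x y. gns_inner \<psi> (T x) y = gns_inner \<phi> x (S y))"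

definition faithful_state :: "('a::star_algebra \<Rightarrow> complex) \<Rightarrow> bool" where
  "faithful_state \<psi> \<longleftrightarrow> clinear \<psi> \<and> \<psi> 1 = 1 \<and>
     (\<forall>x. \<psi> (x\<^sup>\<star> * x) \<in> \<real>\<^sub>\<ge>\<^sub>0) \<and> (\<forall>x. \<psi> (x\<^sup>\<star> * x) = 0 \<longrightarrow> x = 0)"

definition comult :: "('a::star_algebra \<Rightarrow> complex) \<Rightarrow> 'a \<Rightarrow> ('a, 'a) tensor" where
  "comult \<psi> = adj (tensor_functional \<psi> \<psi>) \<psi> mult_map"

definition delta_form :: "('a::star_algebra \<Rightarrow> complex) \<Rightarrow> real \<Rightarrow> bool" where
  "delta_form \<psi> \<delta> \<longleftrightarrow> \<delta> \<ge> 0 \<and> (\<forall>x. mult_map (comult \<psi> x) = complex_of_real (\<delta>\<^sup>2) *\<^sub>C x)"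

definition quantum_set :: "('a::fd_cstar_algebra \<Rightarrow> complex) \<Rightarrow> bool" where
  "quantum_set \<psi> \<longleftrightarrow> faithful_state \<psi> \<and> (\<exists>\<delta>. delta_form \<psi> \<delta>)"

definition delta :: "('a::star_algebra \<Rightarrow> complex) \<Rightarrow> real" where
  "delta \<psi> = (THE \<delta>. delta_form \<psi> \<delta>)"

lemma delta_eqI:
  assumes "delta_form (\<psi> :: 'a::star_algebra \<Rightarrow> complex) \<delta>"
  shows "delta \<psi> = \<delta>"
  unfolding delta_def
proof (rule the_equality[of "delta_form \<psi>", OF assms])
  fix \<epsilon> assume "delta_form \<psi> \<epsilon>"
  then have "complex_of_real (\<epsilon>\<^sup>2) *\<^sub>C (1 :: 'a) = complex_of_real (\<delta>\<^sup>2) *\<^sub>C 1"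
    using assms unfolding delta_form_def by metis
  then have "complex_of_real (\<epsilon>\<^sup>2) = complex_of_real (\<delta>\<^sup>2)"
    by (simp add: complex_vector.scale_right_imp_eq)
  then show "\<epsilon> = \<delta>"
    using \<open>delta_form \<psi> \<epsilon>\<close> assms by (simp add: delta_form_def flip: of_real_power)
qed

definition schur_product ::
  "('a::star_algebra \<Rightarrow> complex) \<Rightarrow> ('a \<Rightarrow> 'a) \<Rightarrow> ('a \<Rightarrow> 'a) \<Rightarrow> 'a \<Rightarrow> 'a" where
  "schur_product \<psi> S T x =
     inverse (complex_of_real ((delta \<psi>)\<^sup>2)) *\<^sub>C mult_map (tensor_map S T (comult \<psi> x))"

definition map_star :: "('a::star_algebra \<Rightarrow> 'a) \<Rightarrow> 'a \<Rightarrow> 'a" where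
  "map_star T x = (T (x\<^sup>\<star>))\<^sup>\<star>"


section \<open>Quantum graphs\<close>

text \<open>A quantum graph \<open>(B, \<psi>, A)\<close> is given by \<open>\<psi>\<close> and \<open>A\<close>; the algebra is their underlying type.\<close>

definition quantum_graph ::
  "('a::fd_cstar_algebra \<Rightarrow> complex) \<Rightarrow> ('a \<Rightarrow> 'a) \<Rightarrow> bool" where
  "quantum_graph \<psi> A \<longleftrightarrow> quantum_set \<psi> \<and> clinear A \<and> schur_product \<psi> A A = A"

definition real_graph :: "('a::star_algebra \<Rightarrow> 'a) \<Rightarrow> bool" where
  "real_graph A \<longleftrightarrow> map_star A = A"

definition undirected_graph ::
  "('a::star_algebra \<Rightarrow> complex) \<Rightarrow> ('a \<Rightarrow> 'a) \<Rightarrow> bool" where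
  "undirected_graph \<psi> A \<longleftrightarrow> real_graph A \<and> A = adj \<psi> \<psi> A"

definition tracial :: "('a::star_algebra \<Rightarrow> complex) \<Rightarrow> bool" where
  "tracial \<psi> \<longleftrightarrow> (\<forall>x y. \<psi> (x * y) = \<psi> (y * x))"

definition regular_graph ::
  "('a::star_algebra \<Rightarrow> complex) \<Rightarrow> ('a \<Rightarrow> 'a) \<Rightarrow> complex \<Rightarrow> bool" where
  "regular_graph \<psi> A d \<longleftrightarrow> A 1 = d *\<^sub>C 1 \<and> adj \<psi> \<psi> A 1 = d *\<^sub>C 1"

definition unital_star_hom :: "('a::star_algebra \<Rightarrow> 'b::star_algebra) \<Rightarrow> bool" where
  "unital_star_hom f \<longleftrightarrow> clinear f \<and> f 1 = 1 \<and> (\<forall>x y. f (x * y) = f x * f y) \<and>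
     (\<forall>x. f (x\<^sup>\<star>) = (f x)\<^sup>\<star>)"

text \<open>\<open>graph_hom \<psi> A \<psi>' A' f\<close>: the *-homomorphism \<open>f : B' \<rightarrow> B\<close> is a graph homomorphism from
  \<open>(B, \<psi>, A)\<close> to \<open>(B', \<psi>', A')\<close>, in the opposite direction of \<open>f\<close>.\<close>

definition graph_hom ::
  "('a::star_algebra \<Rightarrow> complex) \<Rightarrow> ('a \<Rightarrow> 'a) \<Rightarrow>
   ('b::star_algebra \<Rightarrow> complex) \<Rightarrow> ('b \<Rightarrow> 'b) \<Rightarrow> ('b \<Rightarrow> 'a) \<Rightarrow> bool" where
  "graph_hom \<psi> A \<psi>' A' f \<longleftrightarrow> unital_star_hom f \<and>
     schur_product \<psi>' A' (adj \<psi>' \<psi> f \<circ> A \<circ> f) = adj \<psi>' \<psi> f \<circ> A \<circ> f"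

definition surjective_graph_hom ::
  "('a::star_algebra \<Rightarrow> complex) \<Rightarrow> ('a \<Rightarrow> 'a) \<Rightarrow>
   ('b::star_algebra \<Rightarrow> complex) \<Rightarrow> ('b \<Rightarrow> 'b) \<Rightarrow> ('b \<Rightarrow> 'a) \<Rightarrow> bool" where
  "surjective_graph_hom \<psi> A \<psi>' A' f \<longleftrightarrow> graph_hom \<psi> A \<psi>' A' f \<and> inj f"


section \<open>The C*-algebra of pairs of complex numbers\<close>

text \<open>A separate type is needed because the library norm on \<^typ>\<open>complex \<times> complex\<close> is Euclidean,
  not the C*-norm.\<close>

typedef c2 = "UNIV :: (complex \<times> complex) set"
  morphisms of_c2 to_c2 ..

setup_lifting type_definition_c2

instantiation c2 :: star_algebra
begin

lift_definition zero_c2 :: c2 is "(0, 0)" .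
lift_definition one_c2 :: c2 is "(1, 1)" .
lift_definition plus_c2 :: "c2 \<Rightarrow> c2 \<Rightarrow> c2" is "\<lambda>(a, b) (c, d). (a + c, b + d)" .
lift_definition minus_c2 :: "c2 \<Rightarrow> c2 \<Rightarrow> c2" is "\<lambda>(a, b) (c, d). (a - c, b - d)" .
lift_definition uminus_c2 :: "c2 \<Rightarrow> c2" is "\<lambda>(a, b). (- a, - b)" .
lift_definition times_c2 :: "c2 \<Rightarrow> c2 \<Rightarrow> c2" is "\<lambda>(a, b) (c, d). (a * c, b * d)" .
lift_definition scaleC_c2 :: "complex \<Rightarrow> c2 \<Rightarrow> c2" is "\<lambda>r (a, b). (r * a, r * b)" .
lift_definition star_c2 :: "c2 \<Rightarrow> c2" is "\<lambda>(a, b). (cnj a, cnj b)" .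

instance
  by standard (transfer; auto simp: algebra_simps)+

end

instantiation c2 :: real_normed_algebra_1
begin

lift_definition norm_c2 :: "c2 \<Rightarrow> real" is "\<lambda>(a, b). max (cmod a) (cmod b)" .
definition scaleR_c2 :: "real \<Rightarrow> c2 \<Rightarrow> c2" where "scaleR_c2 r x = complex_of_real r *\<^sub>C x"
definition dist_c2 :: "c2 \<Rightarrow> c2 \<Rightarrow> real" where "dist_c2 x y = norm (x - y)"
definition sgn_c2 :: "c2 \<Rightarrow> c2" where "sgn_c2 x = inverse (norm x) *\<^sub>R x"
definition uniformity_c2 :: "(c2 \<times> c2) filter" where
  "uniformity_c2 = (INF e\<in>{0<..}. principal {(x, y). dist x y < e})"
definition open_c2 :: "c2 set \<Rightarrow> bool" where
  "open_c2 U \<longleftrightarrow> (\<forall>x\<in>U. eventually (\<lambda>(x', y). x' = x \<longrightarrow> y \<in> U) uniformity)"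

lemma norm_scaleC_c2: "norm (c *\<^sub>C (x :: c2)) = cmod c * norm x"
  by transfer (auto simp: norm_mult max_mult_distrib_left)

instance
proof
  fix x y :: c2 and r s :: real and U :: "c2 set"
  show "dist x y = norm (x - y)" by (rule dist_c2_def)
  show "sgn x = inverse (norm x) *\<^sub>R x" by (rule sgn_c2_def)
  show "(uniformity :: (c2 \<times> c2) filter) = (INF e\<in>{0<..}. principal {(x, y). dist x y < e})"
    by (rule uniformity_c2_def)
  show "open U \<longleftrightarrow> (\<forall>x\<in>U. eventually (\<lambda>(x', y). x' = x \<longrightarrow> y \<in> U) uniformity)"
    by (rule open_c2_def)
  show "r *\<^sub>R (x + y) = r *\<^sub>R x + r *\<^sub>R y" "(r + s) *\<^sub>R x = r *\<^sub>R x + s *\<^sub>R x"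
    "r *\<^sub>R s *\<^sub>R x = (r * s) *\<^sub>R x" "1 *\<^sub>R x = x"
    "(r *\<^sub>R x) * y = r *\<^sub>R (x * y)" "x * (r *\<^sub>R y) = r *\<^sub>R (x * y)"
    by (simp_all add: scaleR_c2_def scaleC_add_right scaleC_add_left scaleC_scaleC scaleC_one
        mult_scaleC_left mult_scaleC_right)
  show "norm x = 0 \<longleftrightarrow> x = 0"
    by transfer (auto simp: max_def split: if_splits)
  show "norm (x + y) \<le> norm x + norm y"
    by transfer (auto intro!: order_trans[OF norm_triangle_ineq] add_mono)
  show "norm (r *\<^sub>R x) = \<bar>r\<bar> * norm x"
    by (simp add: scaleR_c2_def norm_scaleC_c2)
  show "norm (x * y) \<le> norm x * norm y"
    by transfer (auto simp: norm_mult le_max_iff_disj intro!: mult_mono)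
  show "norm (1 :: c2) = 1"
    by transfer simp
qed

end

instance c2 :: fd_cstar_algebra
proof
  fix x :: c2 and r :: real and c :: complex
  show "r *\<^sub>R x = complex_of_real r *\<^sub>C x"
    by (rule scaleR_c2_def)
  show "norm (c *\<^sub>C x) = cmod c * norm x"
    by (rule norm_scaleC_c2)
  show "norm (x\<^sup>\<star> * x) = (norm x)\<^sup>2"
    by transfer (auto simp: norm_mult power2_eq_square max_def mult_mono
        intro!: antisym mult_mono)
  have "x = (\<Sum>s\<in>{to_c2 (1, 0), to_c2 (0, 1)}.
      (if s = to_c2 (1, 0) then fst (of_c2 x) else snd (of_c2 x)) *\<^sub>C s)" for x
  proof -
    have "to_c2 (1, 0) \<noteq> to_c2 (0, 1)" by (simp add: to_c2_inject)
    moreover have "x = fst (of_c2 x) *\<^sub>C to_c2 (1, 0) + snd (of_c2 x) *\<^sub>C to_c2 (0, 1)"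
      by transfer auto
    ultimately show ?thesis by simp
  qed
  then show "\<exists>S. finite S \<and> (\<forall>x::c2. \<exists>c. x = (\<Sum>s\<in>S. c s *\<^sub>C s))"
    by (intro exI[of _ "{to_c2 (1, 0), to_c2 (0, 1)}"] conjI allI exI) simp_all
next
  fix X :: "nat \<Rightarrow> c2"
  assume X: "Cauchy X"
  define p q where "p n = fst (of_c2 (X n))" and "q n = snd (of_c2 (X n))" for n
  have dist_eq: "dist x y = max (cmod (fst (of_c2 x) - fst (of_c2 y)))
      (cmod (snd (of_c2 x) - snd (of_c2 y)))" for x y
    unfolding dist_c2_def by transfer auto
  have "Cauchy p" "Cauchy q"
    using X unfolding Cauchy_def dist_eq p_def q_def dist_norm by (meson max_less_iff_conj)+
  then obtain a b where ab: "p \<longlonglongrightarrow> a" "q \<longlonglongrightarrow> b"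
    by (meson Cauchy_convergent_iff convergent_def)
  have "(\<lambda>n. max (cmod (p n - a)) (cmod (q n - b))) \<longlonglongrightarrow> max 0 0"
    by (intro tendsto_max tendsto_norm_zero LIM_zero ab)
  moreover have "(\<lambda>n. dist (X n) (to_c2 (a, b))) = (\<lambda>n. max (cmod (p n - a)) (cmod (q n - b)))"
    by (simp add: dist_eq p_def q_def to_c2_inverse)
  ultimately have "(\<lambda>n. dist (X n) (to_c2 (a, b))) \<longlonglongrightarrow> 0" by simp
  then show "convergent X"
    unfolding convergent_def by (blast intro: tendsto_dist_iff[THEN iffD2])
qed

lift_definition c2_state :: "c2 \<Rightarrow> complex" is "\<lambda>(a, b). (a + b) / 2" .

lift_definition c2_swap :: "c2 \<Rightarrow> c2" is "\<lambda>(a, b). (b, a)" .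

text \<open>\<open>T\<^sub>2 = (c2, c2_state, id)\<close> and \<open>K\<^sub>2 = (c2, c2_state, c2_swap)\<close>\<close>

definition connected_graph :: "('a::star_algebra \<Rightarrow> complex) \<Rightarrow> ('a \<Rightarrow> 'a) \<Rightarrow> bool" where
  "connected_graph \<psi> A \<longleftrightarrow> \<not> (\<exists>f. surjective_graph_hom \<psi> A c2_state id f)"

definition bipartite_graph :: "('a::star_algebra \<Rightarrow> complex) \<Rightarrow> ('a \<Rightarrow> 'a) \<Rightarrow> bool" where
  "bipartite_graph \<psi> A \<longleftrightarrow> (\<exists>f. surjective_graph_hom \<psi> A c2_state c2_swap f)"


section \<open>Spectrum\<close>

definition op_spectrum :: "('a::complex_vector \<Rightarrow> 'a) \<Rightarrow> complex set" where
  "op_spectrum A = {c. \<not> bij (\<lambda>x. A x - c *\<^sub>C x)}"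

text \<open>The geometric multiplicity; for the self-adjoint operators considered here it agrees with the
  algebraic one.\<close>

definition op_multiplicity :: "('a::complex_vector \<Rightarrow> 'a) \<Rightarrow> complex \<Rightarrow> nat" where
  "op_multiplicity A c = cdim {x. A x = c *\<^sub>C x}"

end

theory Submission
  imports Defs "HOL-Computational_Algebra.Fundamental_Theorem_Algebra"
begin

text \<open>
  Write \<open>\<delta>\<close> for the constant of the \<open>\<delta>\<close>-form and \<open>q = 1 - p\<close>. A unital *-homomorphism out of
  \<open>\<complex>\<^sup>2\<close> is a projection \<open>p\<close>, and on \<open>\<complex>\<^sup>2\<close> the Schur product is the entrywise product of
  \<open>2 \<times> 2\<close> matrices. So the graph is disconnected iff some nontrivial \<open>p\<close> has
  \<open>\<psi>(p A(q)) = 0 = \<psi>(q A(p))\<close>, that is, no edges run between the two parts, and it is bipartite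
  iff some nontrivial \<open>p\<close> has \<open>\<psi>(p A(p)) = 0 = \<psi>(q A(q))\<close>, that is, no edges run inside a part.

  For a family \<open>(e)\<close> with \<open>x = \<Sum> \<psi>(e\<^sup>\<star> x) e\<close> for all \<open>x\<close>, the trace property turns the Schur
  idempotence of \<open>A\<close> into
  \<open>\<Sum> A(x e\<^sup>\<star>) A(e y) = \<delta>\<^sup>2 A(x y)\<close> (lemma \<open>schur_idempotent\<close>). As \<open>A(x\<^sup>\<star>) = A(x)\<^sup>\<star>\<close>, suitable
  quadratic expressions in \<open>A\<close> become sums of squares \<open>\<Sum> \<psi>(|g(e)|\<^sup>2)\<close>, and such a sum vanishes only if
  each \<open>g(e)\<close> does. This is used twice.

  \<^item> \<open>\<psi>(p A(q)) = 0\<close> forces \<open>A(q) p = 0\<close> for arbitrary projections \<open>p\<close> and \<open>q\<close>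
    (\<open>no_edges_imp_orthogonal\<close>). In a bipartition this gives
    \<open>A(p) = d q\<close> and \<open>A(q) = d p\<close>, so that \<open>p - q\<close> is an eigenvector for \<open>- d\<close>.

  \<^item> If \<open>x\<close> is self-adjoint with \<open>A(x) = - d x\<close>, then the signless Laplacian form
    \<open>2 \<delta>\<^sup>2 \<psi>(x (d + A) x)\<close> is zero. It equals \<open>\<Sum> \<psi>(|A(e x) + A(e) x|\<^sup>2)\<close>, hence \<open>A(z x) = - A(z) x\<close>
    for every \<open>z\<close> (\<open>antisymmetric_eigenvector\<close>): \<open>x\<close> changes sign along each edge.

  In the second case \<open>h = x\<^sup>2\<close> satisfies \<open>A(z h) = A(z) h\<close>, so it is constant along edges. Were
  \<open>h\<close> not a scalar, an eigenprojection of \<open>h\<close> would disconnect the graph (\<open>connected_imp_scalar\<close>).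
  After rescaling, \<open>x\<^sup>2 = 1\<close>, and if \<open>d \<noteq> 0\<close> then \<open>p = (1 + x) / 2\<close> is a bipartition.

  If \<open>d = 0\<close>, then \<open>A = 0\<close>, so every nontrivial projection disconnects the graph and
  connectedness leaves only the one-dimensional algebra. There the graph is not bipartite and \<open>0\<close> is a simple eigenvalue.
\<close>

section \<open>Linear maps, involutions and faithful states\<close>

lemma clinear_sum: "clinear f \<Longrightarrow> f (\<Sum>i\<in>I. g i) = (\<Sum>i\<in>I. f (g i))"
  by (induction I rule: infinite_finite_induct) (simp_all add: clinear_simps)

lemma clinear_diff: "clinear f \<Longrightarrow> f (x - y) = f x - f y"
  by (metis add_diff_cancel_right' clinear_simps(1) diff_add_cancel)

lemma clinear_minus: "clinear f \<Longrightarrow> f (- x) = - f x"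
  using clinear_diff[of f 0 x] by (simp add: clinear_simps)

lemma star_zero [simp]: "(0 :: 'a::star_algebra)\<^sup>\<star> = 0"
  using star_add[of "0 :: 'a" 0] by simp

lemma star_one [simp]: "(1 :: 'a::star_algebra)\<^sup>\<star> = 1"
  by (metis mult_1_left mult_1_right star_mult star_star)

lemma star_minus: "(- x)\<^sup>\<star> = - (x :: 'a::star_algebra)\<^sup>\<star>"
  by (metis add_eq_0_iff star_add star_zero)

lemma star_diff: "(x - y)\<^sup>\<star> = (x :: 'a::star_algebra)\<^sup>\<star> - y\<^sup>\<star>"
  using star_add[of "x - y" y] by simp

lemma star_sum: "(\<Sum>i\<in>I. g i)\<^sup>\<star> = (\<Sum>i\<in>I. (g i :: 'a::star_algebra)\<^sup>\<star>)"
  by (induction I rule: infinite_finite_induct) (simp_all add: star_add)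

lemmas star_simps = star_add star_diff star_minus star_mult star_star star_scaleC star_sum

lemma state_linear: "faithful_state \<psi> \<Longrightarrow> clinear \<psi>"
  by (simp add: faithful_state_def)

lemma state_eq_0: "faithful_state \<psi> \<Longrightarrow> \<psi> (x\<^sup>\<star> * x) = 0 \<Longrightarrow> x = 0"
  by (simp add: faithful_state_def)

lemma state_nonneg:
  assumes "faithful_state \<psi>"
  shows "Im (\<psi> (x\<^sup>\<star> * x)) = 0" "Re (\<psi> (x\<^sup>\<star> * x)) \<ge> 0"
  using assms by (auto simp: faithful_state_def complex_nonneg_Reals_iff)

text \<open>Positivity makes \<open>\<psi>(z) + \<psi>(z\<^sup>\<star>)\<close> real for every \<open>z\<close>; \<open>z = x\<close> and \<open>z = \<i> x\<close> give the
  imaginary and the real part of the claim.\<close>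

lemma state_star:
  assumes "faithful_state \<psi>"
  shows "\<psi> (x\<^sup>\<star>) = cnj (\<psi> x)"
proof -
  note lin = clinear_simps[OF state_linear[OF assms]]
  have "Im (\<psi> (c *\<^sub>C x)) + Im (\<psi> ((c *\<^sub>C x)\<^sup>\<star>)) = 0" for c
    using state_nonneg(1)[OF assms, of "1 + c *\<^sub>C x"] state_nonneg(1)[OF assms, of "c *\<^sub>C x"]
      assms
    by (simp add: star_add distrib_left distrib_right lin faithful_state_def)
  from this[of 1] this[of \<i>] show ?thesis
    by (simp add: star_scaleC lin clinear_minus[OF state_linear[OF assms]]
        scaleC_complex_def complex_eq_iff)
qed

lemma finite_spanning_set:
  obtains S :: "'a::fd_cstar_algebra set" where "finite S" "complex_vector.span S = UNIV"
proof -
  obtain S :: "'a set" where S: "finite S" "\<And>x. \<exists>c. x = (\<Sum>s\<in>S. c s *\<^sub>C s)"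
    using finite_dimensional by blast
  have "x \<in> complex_vector.span S" for x
  proof -
    obtain c where "x = (\<Sum>s\<in>S. c s *\<^sub>C s)" using S(2) by blast
    then show ?thesis
      by (simp only: complex_vector.span_sum complex_vector.span_scale complex_vector.span_base)
  qed
  with S(1) show ?thesis using that by blast
qed

lemma sum_state_eq_0:
  assumes \<psi>: "faithful_state \<psi>" and "finite I" "(\<Sum>i\<in>I. \<psi> ((g i)\<^sup>\<star> * g i)) = 0" "i \<in> I"
  shows "g i = 0"
proof -
  have "(\<Sum>i\<in>I. Re (\<psi> ((g i)\<^sup>\<star> * g i))) = 0"
    using assms(3) by (simp flip: Re_sum)
  then have "Re (\<psi> ((g i)\<^sup>\<star> * g i)) = 0"
    using assms(2,4) state_nonneg(2)[OF \<psi>] by (subst (asm) sum_nonneg_eq_0_iff) auto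
  then show ?thesis
    using state_nonneg(1)[OF \<psi>, of "g i"] by (intro state_eq_0[OF \<psi>]) (simp add: complex_eq_iff)
qed

section \<open>Parseval frames of the GNS space\<close>

text \<open>Parseval frames serve as coordinates: every computation below expands an element by the
  reproducing formula, and the formula survives applying the involution to all of \<open>E\<close> if the state
  is a trace.\<close>

definition gns_frame :: "('a::star_algebra \<Rightarrow> complex) \<Rightarrow> 'a set \<Rightarrow> bool" where
  "gns_frame \<psi> E \<longleftrightarrow> finite E \<and> (\<forall>x. (\<Sum>e\<in>E. gns_inner \<psi> e x *\<^sub>C e) = x)"

lemma frame_expansion: "gns_frame \<psi> E \<Longrightarrow> (\<Sum>e\<in>E. \<psi> (e\<^sup>\<star> * x) *\<^sub>C e) = x"
  by (simp add: gns_frame_def gns_inner_def)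

lemma clinear_sum_scaleC:
  "clinear f \<Longrightarrow> f (\<Sum>i\<in>I. c i *\<^sub>C g i) = (\<Sum>i\<in>I. c i *\<^sub>C f (g i))"
  by (simp add: clinear_sum clinear_simps)

lemma frame_extensionality:
  assumes "gns_frame \<psi> E" "clinear f" "\<And>e. e \<in> E \<Longrightarrow> f e = 0"
  shows "f x = 0"
proof -
  have "f x = f (\<Sum>e\<in>E. \<psi> (e\<^sup>\<star> * x) *\<^sub>C e)"
    by (simp only: frame_expansion[OF assms(1)])
  also have "\<dots> = 0"
    by (simp add: clinear_sum_scaleC[OF assms(2)] assms(3))
  finally show ?thesis .
qed

text \<open>Gram--Schmidt, adding one vector of a finite spanning set at a time.\<close>

lemma ex_gns_frame:
  fixes \<psi> :: "'a::fd_cstar_algebra \<Rightarrow> complex"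
  assumes \<psi>: "faithful_state \<psi>"
  obtains E where "gns_frame \<psi> E"
proof -
  note lin = clinear_simps[OF state_linear[OF \<psi>]] clinear_sum[OF state_linear[OF \<psi>]]
    clinear_diff[OF state_linear[OF \<psi>]] scaleC_complex_def
  have GS: "\<exists>E. finite E \<and> (\<forall>e\<in>E. \<forall>e'\<in>E. \<psi> (e\<^sup>\<star> * e') = (if e = e' then 1 else 0)) \<and>
      (\<forall>x\<in>S. (\<Sum>e\<in>E. \<psi> (e\<^sup>\<star> * x) *\<^sub>C e) = x)" if "finite S" for S
    using that
  proof (induction S)
    case empty
    show ?case by (rule exI[of _ "{}"]) simp
  next
    case (insert s S)
    then obtain E where E: "finite E"
      "\<And>e e'. e \<in> E \<Longrightarrow> e' \<in> E \<Longrightarrow> \<psi> (e\<^sup>\<star> * e') = (if e = e' then 1 else 0)"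
      "\<And>x. x \<in> S \<Longrightarrow> (\<Sum>e\<in>E. \<psi> (e\<^sup>\<star> * x) *\<^sub>C e) = x" by auto
    define r where "r = s - (\<Sum>e\<in>E. \<psi> (e\<^sup>\<star> * s) *\<^sub>C e)"
    have orth: "\<psi> (e\<^sup>\<star> * r) = 0" if "e \<in> E" for e
      using that E(1,2)
      by (simp add: r_def right_diff_distrib sum_distrib_left mult_scaleC_right lin sum.delta
          if_distrib[of "\<lambda>x. _ * x"] cong: if_cong)
    have orth': "\<psi> (r\<^sup>\<star> * e) = 0" if "e \<in> E" for e
      using orth[OF that] state_star[OF \<psi>, of "e\<^sup>\<star> * r"] by (simp add: star_simps)
    \<comment> \<open>The component of \<open>s\<close> orthogonal to \<open>E\<close> is normalised and added, unless it is zero.\<close>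
    show ?case
    proof (cases "r = 0")
      case True
      with E show ?thesis by (intro exI[of _ E]) (auto simp: r_def)
    next
      case False
      define n where "n = Re (\<psi> (r\<^sup>\<star> * r))"
      have rr: "\<psi> (r\<^sup>\<star> * r) = complex_of_real n"
        using state_nonneg(1)[OF \<psi>, of r] by (simp add: n_def complex_eq_iff)
      have "n \<noteq> 0"
        using state_eq_0[OF \<psi>, of r] False rr by auto
      then have n: "n > 0"
        using state_nonneg(2)[OF \<psi>, of r] unfolding n_def by linarith
      define c where "c = complex_of_real (inverse (sqrt n))"
      define u where "u = c *\<^sub>C r"
      have cc: "cnj c = c" "c * c * complex_of_real n = 1"
        using n by (simp_all add: c_def flip: of_real_mult of_real_inverse)
          (simp add: field_simps)
      have u: "\<psi> (u\<^sup>\<star> * u) = 1"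
        using cc by (simp add: u_def star_simps mult_scaleC_left mult_scaleC_right lin rr ac_simps)
      have uE: "\<psi> (u\<^sup>\<star> * e) = 0" "\<psi> (e\<^sup>\<star> * u) = 0" if "e \<in> E" for e
        using orth[OF that] orth'[OF that]
        by (simp_all add: u_def star_simps mult_scaleC_left mult_scaleC_right lin)
      have notin: "u \<notin> E" using u uE(1)[of u] by auto
      have us: "\<psi> (u\<^sup>\<star> * x) = 0" if "x \<in> S" for x
      proof -
        have "\<psi> (u\<^sup>\<star> * (\<Sum>e\<in>E. \<psi> (e\<^sup>\<star> * x) *\<^sub>C e)) = 0"
          by (simp add: sum_distrib_left mult_scaleC_right lin uE)
        then show ?thesis by (simp only: E(3)[OF that])
      qed
      have "\<psi> (r\<^sup>\<star> * s) = \<psi> (r\<^sup>\<star> * (r + (\<Sum>e\<in>E. \<psi> (e\<^sup>\<star> * s) *\<^sub>C e)))"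
        by (simp add: r_def)
      also have "\<dots> = complex_of_real n"
        by (simp add: distrib_left sum_distrib_left mult_scaleC_right lin orth' rr)
      finally have "\<psi> (u\<^sup>\<star> * s) *\<^sub>C u = (c * complex_of_real n * c) *\<^sub>C r"
        by (simp add: u_def star_simps mult_scaleC_left lin cc scaleC_scaleC)
      then have "\<psi> (u\<^sup>\<star> * s) *\<^sub>C u = r"
        using cc(2) by (simp add: ac_simps)
      then have "(\<Sum>e\<in>insert u E. \<psi> (e\<^sup>\<star> * s) *\<^sub>C e) = s"
        using E(1) notin by (simp add: r_def)
      then show ?thesis
        using E notin u uE us by (intro exI[of _ "insert u E"]) auto
    qed
  qed
  obtain S :: "'a set" where S: "finite S" "\<And>x. \<exists>c. x = (\<Sum>s\<in>S. c s *\<^sub>C s)"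
    using finite_dimensional by blast
  obtain E where E: "finite E" "\<And>x. x \<in> S \<Longrightarrow> (\<Sum>e\<in>E. \<psi> (e\<^sup>\<star> * x) *\<^sub>C e) = x"
    using GS[OF S(1)] by auto
  have "(\<Sum>e\<in>E. \<psi> (e\<^sup>\<star> * x) *\<^sub>C e) = x" for x
  proof -
    let ?P = "\<lambda>x. \<Sum>e\<in>E. \<psi> (e\<^sup>\<star> * x) *\<^sub>C e"
    have P: "clinear ?P"
      unfolding clinear_iff
      by (simp add: distrib_left lin scaleC_add_left sum.distrib mult_scaleC_right
          complex_vector.scale_sum_right)
    obtain c where "x = (\<Sum>s\<in>S. c s *\<^sub>C s)" using S(2) by blast
    then show ?thesis
      using clinear_sum_scaleC[OF P, of c "\<lambda>s. s" S] E(2) by simp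
  qed
  then show ?thesis
    using E(1) by (intro that[of E]) (simp add: gns_frame_def gns_inner_def)
qed

section \<open>Adjoints\<close>

text \<open>The property of the domain that makes adjoints unique.\<close>

definition gns_nondegenerate :: "('a::star_algebra \<Rightarrow> complex) \<Rightarrow> bool" where
  "gns_nondegenerate \<phi> \<longleftrightarrow>
     (\<forall>u v. (\<forall>x. gns_inner \<phi> x u = gns_inner \<phi> x v) \<longrightarrow> u = v)"

lemma gns_nondegenerateD:
  "gns_nondegenerate \<phi> \<Longrightarrow> (\<And>x. gns_inner \<phi> x u = gns_inner \<phi> x v) \<Longrightarrow> u = v"
  unfolding gns_nondegenerate_def by blast

lemma gns_nondegenerate_frame:
  assumes "gns_frame \<phi> E"
  shows "gns_nondegenerate \<phi>"
  unfolding gns_nondegenerate_def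
proof (intro allI impI)
  fix u v assume "\<forall>x. gns_inner \<phi> x u = gns_inner \<phi> x v"
  then have "(\<Sum>e\<in>E. \<phi> (e\<^sup>\<star> * u) *\<^sub>C e) = (\<Sum>e\<in>E. \<phi> (e\<^sup>\<star> * v) *\<^sub>C e)"
    by (simp add: gns_inner_def)
  then show "u = v"
    by (simp only: frame_expansion[OF assms])
qed

lemma adj_eqI:
  assumes "gns_nondegenerate \<phi>"
    and "\<And>x y. gns_inner \<psi> (T x) y = gns_inner \<phi> x (S y)"
  shows "adj \<phi> \<psi> T = S"
  unfolding adj_def
proof (rule the_equality)
  show "\<forall>x y. gns_inner \<psi> (T x) y = gns_inner \<phi> x (S y)"
    using assms(2) by blast
  fix S' assume "\<forall>x y. gns_inner \<psi> (T x) y = gns_inner \<phi> x (S' y)"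
  then show "S' = S"
    using assms(2) by (intro ext gns_nondegenerateD[OF assms(1)]) metis
qed

text \<open>The adjoint is introduced by a definite description, so its defining property requires
  existence; the frame supplies the witness \<open>y \<mapsto> \<Sum> \<psi>((T e)\<^sup>\<star> y) e\<close>.\<close>

lemma gns_inner_adj:
  assumes \<phi>: "faithful_state \<phi>" and \<psi>: "clinear \<psi>" and E: "gns_frame \<phi> E" and T: "clinear T"
  shows "gns_inner \<psi> (T x) y = gns_inner \<phi> x (adj \<phi> \<psi> T y)"
proof -
  define S where "S y = (\<Sum>e\<in>E. \<psi> ((T e)\<^sup>\<star> * y) *\<^sub>C e)" for y
  have S: "gns_inner \<psi> (T x) y = gns_inner \<phi> x (S y)" for x y
  proof -
    have "T x = T (\<Sum>e\<in>E. \<phi> (e\<^sup>\<star> * x) *\<^sub>C e)"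
      by (simp only: frame_expansion[OF E])
    also have "\<dots> = (\<Sum>e\<in>E. \<phi> (e\<^sup>\<star> * x) *\<^sub>C T e)"
      by (rule clinear_sum_scaleC[OF T])
    finally have Tx: "T x = (\<Sum>e\<in>E. \<phi> (e\<^sup>\<star> * x) *\<^sub>C T e)" .
    have "gns_inner \<psi> (T x) y = (\<Sum>e\<in>E. cnj (\<phi> (e\<^sup>\<star> * x)) * \<psi> ((T e)\<^sup>\<star> * y))"
      by (simp add: gns_inner_def Tx star_simps sum_distrib_right mult_scaleC_left
          clinear_sum[OF \<psi>] clinear_simps[OF \<psi>] scaleC_complex_def)
    also have "\<dots> = gns_inner \<phi> x (S y)"
      by (simp add: gns_inner_def S_def sum_distrib_left mult_scaleC_right
          clinear_sum[OF state_linear[OF \<phi>]] clinear_simps[OF state_linear[OF \<phi>]]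
          scaleC_complex_def mult.commute star_simps flip: state_star[OF \<phi>])
    finally show ?thesis .
  qed
  have "adj \<phi> \<psi> T = S"
    by (rule adj_eqI[OF gns_nondegenerate_frame[OF E] S])
  then show ?thesis by (simp only: S)
qed

lemma frame_expansion_star:
  assumes "faithful_state \<psi>" "gns_frame \<psi> E"
  shows "(\<Sum>e\<in>E. \<psi> (x * e) *\<^sub>C e\<^sup>\<star>) = x"
proof -
  have "(\<Sum>e\<in>E. \<psi> (e\<^sup>\<star> * x\<^sup>\<star>) *\<^sub>C e)\<^sup>\<star> = x"
    by (simp only: frame_expansion[OF assms(2)] star_star)
  then show ?thesis
    by (simp add: star_simps flip: state_star[OF assms(1)])
qed

text \<open>For a trace the involution is antiunitary, so it carries frames to frames.\<close>

lemma frame_star: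
  assumes "faithful_state \<psi>" "tracial \<psi>" "gns_frame \<psi> E"
  shows "gns_frame \<psi> (star ` E)"
proof -
  have "inj_on star E" for E :: "'a set"
    by (metis inj_onI star_star)
  moreover have "\<psi> (e * x) = \<psi> (x * e)" for e x
    using assms(2) by (simp add: tracial_def)
  ultimately show ?thesis
    using frame_expansion_star[OF assms(1,3)] assms(3)
    by (simp add: gns_frame_def gns_inner_def sum.reindex star_star)
qed

section \<open>The comultiplication and the Schur product\<close>

lemma clinear_tensor_functional: "clinear (tensor_functional \<phi> \<psi>)"
  unfolding tensor_functional_def by (rule clinear_tensor_lift)

lemma clinear_mult_map: "clinear (mult_map)"
  unfolding mult_map_def by (rule clinear_tensor_lift)

lemma clinear_tensor_map: "clinear (tensor_map S T)"
  unfolding tensor_map_def by (rule clinear_tensor_lift)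

lemma tensor_pure_sum:
  "(\<Sum>i\<in>I. f i) \<otimes>\<^sub>t y = (\<Sum>i\<in>I. f i \<otimes>\<^sub>t y)" "y \<otimes>\<^sub>t (\<Sum>i\<in>I. f i) = (\<Sum>i\<in>I. y \<otimes>\<^sub>t f i)"
  using cbilinear_tensor_pure by (auto simp: cbilinear_def intro: clinear_sum)

text \<open>The elements \<open>e \<otimes> e'\<close> reproduce the tensor square. They are kept as a double sum, since distinct
  pairs may give equal tensors and the set of these tensors need not be a frame.\<close>

lemma gns_nondegenerate_tensor:
  fixes \<psi> :: "'a::star_algebra \<Rightarrow> complex"
  assumes \<psi>: "faithful_state \<psi>" and E: "gns_frame \<psi> E"
  shows "gns_nondegenerate (tensor_functional \<psi> \<psi>)"
proof -
  let ?tf = "tensor_functional \<psi> \<psi>"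
  note tf = clinear_simps[OF clinear_tensor_functional]
    tensor_functional_pure[OF state_linear[OF \<psi>] state_linear[OF \<psi>]]
  have expand: "(\<Sum>e\<in>E. \<Sum>e'\<in>E. ?tf ((e \<otimes>\<^sub>t e')\<^sup>\<star> * t) *\<^sub>C (e \<otimes>\<^sub>t e')) = t" for t
  proof (induction t rule: tensor_induct)
    case zero
    show ?case by (simp add: tf)
  next
    case (add x y t)
    have "x \<otimes>\<^sub>t y = (\<Sum>e\<in>E. \<psi> (e\<^sup>\<star> * x) *\<^sub>C e) \<otimes>\<^sub>t (\<Sum>e\<in>E. \<psi> (e\<^sup>\<star> * y) *\<^sub>C e)"
      by (simp only: frame_expansion[OF E])
    also have "\<dots> = (\<Sum>e\<in>E. \<Sum>e'\<in>E. (\<psi> (e\<^sup>\<star> * x) * \<psi> (e'\<^sup>\<star> * y)) *\<^sub>C (e \<otimes>\<^sub>t e'))"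
      by (simp add: tensor_pure_sum cbilinear_simps[OF cbilinear_tensor_pure] scaleC_scaleC
          complex_vector.scale_sum_right, subst sum.swap, simp add: mult.commute)
    finally have "(\<Sum>e\<in>E. \<Sum>e'\<in>E. (\<psi> (e\<^sup>\<star> * x) * \<psi> (e'\<^sup>\<star> * y)) *\<^sub>C (e \<otimes>\<^sub>t e')) = x \<otimes>\<^sub>t y" ..
    then show ?case
      by (simp only: distrib_left tf scaleC_add_left sum.distrib add.IH[unfolded star_tensor_pure] star_tensor_pure
          times_tensor_pure)
  qed
  show ?thesis
    unfolding gns_nondegenerate_def
  proof (intro allI impI)
    fix u v assume "\<forall>s. gns_inner ?tf s u = gns_inner ?tf s v"
    then have "(\<Sum>e\<in>E. \<Sum>e'\<in>E. ?tf ((e \<otimes>\<^sub>t e')\<^sup>\<star> * u) *\<^sub>C (e \<otimes>\<^sub>t e')) =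
        (\<Sum>e\<in>E. \<Sum>e'\<in>E. ?tf ((e \<otimes>\<^sub>t e')\<^sup>\<star> * v) *\<^sub>C (e \<otimes>\<^sub>t e'))"
      by (simp only: gns_inner_def)
    then show "u = v"
      by (simp only: expand)
  qed
qed

text \<open>\<open>m\<^sup>\<dagger>\<close> is a bimodule map with \<open>m\<^sup>\<dagger> 1 = \<Sum> e \<otimes> e\<^sup>\<star>\<close>. Being free to split the argument as
  \<open>x y\<close> is what later produces squares.\<close>

lemma comult_mult:
  fixes \<psi> :: "'a::star_algebra \<Rightarrow> complex"
  assumes \<psi>: "faithful_state \<psi>" and E: "gns_frame \<psi> E"
  shows "comult \<psi> (x * y) = (\<Sum>e\<in>E. (x * e) \<otimes>\<^sub>t (e\<^sup>\<star> * y))"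
proof -
  let ?tf = "tensor_functional \<psi> \<psi>"
  note tf = clinear_simps[OF clinear_tensor_functional] clinear_sum[OF clinear_tensor_functional]
    tensor_functional_pure[OF state_linear[OF \<psi>] state_linear[OF \<psi>]]
  note lin = clinear_simps[OF state_linear[OF \<psi>]] clinear_sum[OF state_linear[OF \<psi>]]
  have key: "gns_inner \<psi> (mult_map s) (x * y) =
      gns_inner ?tf s (\<Sum>e\<in>E. (x * e) \<otimes>\<^sub>t (e\<^sup>\<star> * y))" for s x y
  proof (induction s rule: tensor_induct)
    case zero
    show ?case by (simp add: gns_inner_def clinear_simps[OF clinear_mult_map] lin tf)
  next
    case (add a b t)
    have "\<psi> (b\<^sup>\<star> * a\<^sup>\<star> * x * y) = \<psi> (b\<^sup>\<star> * (\<Sum>e\<in>E. \<psi> (a\<^sup>\<star> * x * e) *\<^sub>C e\<^sup>\<star>) * y)"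
      by (simp only: frame_expansion_star[OF \<psi> E], simp only: mult.assoc)
    also have "\<dots> = (\<Sum>e\<in>E. \<psi> (a\<^sup>\<star> * (x * e)) * \<psi> (b\<^sup>\<star> * (e\<^sup>\<star> * y)))"
      by (simp add: sum_distrib_left sum_distrib_right mult_scaleC_left mult_scaleC_right lin
          scaleC_complex_def mult.assoc)
    finally show ?case
      using add by (simp add: gns_inner_def clinear_simps[OF clinear_mult_map] mult_map_pure
          star_simps distrib_right lin tf sum_distrib_left mult.assoc sum.distrib)
  qed
  \<comment> \<open>The definite description fixes the comultiplication through the splitting \<open>w = 1 w\<close>;
      nondegeneracy then identifies it with every other splitting.\<close>
  define C where "C w = (\<Sum>e\<in>E. (1 * e) \<otimes>\<^sub>t (e\<^sup>\<star> * w))" for w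
  have C: "comult \<psi> = C"
    unfolding comult_def
    by (rule adj_eqI[OF gns_nondegenerate_tensor[OF \<psi> E]])
      (use key[of _ 1] in \<open>simp add: C_def\<close>)
  show ?thesis
    by (rule gns_nondegenerateD[OF gns_nondegenerate_tensor[OF \<psi> E]])
      (use key[of _ 1 "x * y"] key[of _ x y] in \<open>simp add: C C_def\<close>)
qed

lemma schur_product_mult:
  assumes \<psi>: "faithful_state \<psi>" and E: "gns_frame \<psi> E" and "clinear S" "clinear T"
  shows "schur_product \<psi> S T (x * y) =
    inverse (complex_of_real ((delta \<psi>)\<^sup>2)) *\<^sub>C (\<Sum>e\<in>E. S (x * e) * T (e\<^sup>\<star> * y))"
  by (simp add: schur_product_def comult_mult[OF \<psi> E] clinear_sum[OF clinear_tensor_map]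
      tensor_map_pure[OF assms(3,4)] clinear_sum[OF clinear_mult_map] mult_map_pure)

text \<open>If \<open>\<delta> = 0\<close>, then \<open>\<Sum> e e\<^sup>\<star> = m m\<^sup>\<dagger> 1 = 0\<close>, so all elements of a frame vanish, and with them \<open>1\<close>.\<close>

lemma delta_pos:
  fixes \<psi> :: "'b::fd_cstar_algebra \<Rightarrow> complex"
  assumes "quantum_set \<psi>"
  shows "delta \<psi> > 0"
proof -
  have \<psi>: "faithful_state \<psi>" using assms by (simp add: quantum_set_def)
  obtain \<delta> where "delta_form \<psi> \<delta>" using assms by (auto simp: quantum_set_def)
  then have \<delta>: "delta_form \<psi> (delta \<psi>)" by (simp add: delta_eqI)
  obtain E where E: "gns_frame \<psi> E" using ex_gns_frame[OF \<psi>] .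
  have "delta \<psi> \<noteq> 0"
  proof
    assume 0: "delta \<psi> = 0"
    have "(\<Sum>e\<in>E. \<psi> ((e\<^sup>\<star>)\<^sup>\<star> * e\<^sup>\<star>)) = \<psi> (mult_map (comult \<psi> (1 * 1)))"
      unfolding comult_mult[OF \<psi> E]
      by (simp add: clinear_sum[OF clinear_mult_map] mult_map_pure star_star
          clinear_sum[OF state_linear[OF \<psi>]])
    also have "\<dots> = 0"
      using \<delta> 0 by (simp add: delta_form_def clinear_simps[OF state_linear[OF \<psi>]])
    finally have "e\<^sup>\<star> = 0" if "e \<in> E" for e
      using that E by (intro sum_state_eq_0[OF \<psi>, of E star]) (simp_all add: gns_frame_def)
    then have "(1 :: 'b) = 0"
      using frame_expansion_star[OF \<psi> E, of 1] by simp
    then show False by simp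
  qed
  then show ?thesis
    using \<delta> by (simp add: delta_form_def)
qed

section \<open>Homomorphisms from the algebra of pairs\<close>

lift_definition c2_e1 :: c2 is "(1, 0)" .
lift_definition c2_e2 :: c2 is "(0, 1)" .

lemma c2_e_simps [simp]:
  "c2_e1 * c2_e1 = c2_e1" "c2_e2 * c2_e2 = c2_e2" "c2_e1 * c2_e2 = 0" "c2_e2 * c2_e1 = 0"
  "c2_e1\<^sup>\<star> = c2_e1" "c2_e2\<^sup>\<star> = c2_e2" "c2_swap c2_e1 = c2_e2" "c2_swap c2_e2 = c2_e1"
  "c2_e1 \<noteq> 0" "c2_e1 \<noteq> 1"
  by (transfer; simp)+

lemma c2_e2_eq: "c2_e2 = 1 - c2_e1"
  by transfer simp

lemma c2_e_sum: "c2_e1 + c2_e2 = 1"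
  by transfer simp

lemma c2_decomp: "u = fst (of_c2 u) *\<^sub>C c2_e1 + snd (of_c2 u) *\<^sub>C c2_e2"
  by transfer auto

lemma c2_eqI: "fst (of_c2 u) = fst (of_c2 v) \<Longrightarrow> snd (of_c2 u) = snd (of_c2 v) \<Longrightarrow> u = v"
  by transfer (auto simp: prod_eq_iff)

lemma c2_mult_e:
  "u * c2_e1 = fst (of_c2 u) *\<^sub>C c2_e1" "u * c2_e2 = snd (of_c2 u) *\<^sub>C c2_e2"
  by (transfer; auto)+

lemma c2_mult_e_eq_iff:
  "c2_e1 * u = u \<longleftrightarrow> snd (of_c2 u) = 0" "c2_e2 * u = u \<longleftrightarrow> fst (of_c2 u) = 0"
  by (transfer; auto)+

lemma clinear_c2_swap: "clinear c2_swap"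
  unfolding clinear_iff by (intro conjI allI; transfer; auto)

lemma c2_state_star_mult:
  "c2_state (u\<^sup>\<star> * u) =
    complex_of_real (((cmod (fst (of_c2 u)))\<^sup>2 + (cmod (snd (of_c2 u)))\<^sup>2) / 2)"
  by transfer (auto simp: complex_norm_square mult.commute simp del: of_real_power)

lemma faithful_c2_state: "faithful_state c2_state"
  unfolding faithful_state_def
proof (intro conjI allI impI)
  show "clinear c2_state"
    unfolding clinear_iff
    by (intro conjI allI; transfer; auto simp: scaleC_complex_def field_simps)
  show "c2_state 1 = 1"
    by transfer simp
  show "c2_state (u\<^sup>\<star> * u) \<in> \<real>\<^sub>\<ge>\<^sub>0" for u
    by (simp add: c2_state_star_mult complex_nonneg_Reals_iff)
  show "u = 0" if "c2_state (u\<^sup>\<star> * u) = 0" for u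
  proof -
    have "(cmod (fst (of_c2 u)))\<^sup>2 + (cmod (snd (of_c2 u)))\<^sup>2 = 0"
      using that by (simp add: c2_state_star_mult flip: of_real_power of_real_add)
    then have "fst (of_c2 u) = 0" "snd (of_c2 u) = 0"
      by (simp_all add: sum_power2_eq_zero_iff)
    then show ?thesis
      by (transfer; auto)
  qed
qed

text \<open>The minimal projections have squared norm \<open>1 / 2\<close> for the uniform state, whence \<open>\<surd>2\<close>.\<close>

lemma frame_c2_state:
  "gns_frame c2_state {complex_of_real (sqrt 2) *\<^sub>C c2_e1, complex_of_real (sqrt 2) *\<^sub>C c2_e2}"
  (is "gns_frame _ {?f1, ?f2}")
proof -
  have ne: "?f1 \<noteq> ?f2"
    by transfer simp
  have sq: "complex_of_real (sqrt 2) * complex_of_real (sqrt 2) = 2"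
    by (simp flip: of_real_mult)
  have "c2_state (?f1\<^sup>\<star> * u) *\<^sub>C ?f1 + c2_state (?f2\<^sup>\<star> * u) *\<^sub>C ?f2 = u" for u
    using sq by transfer (auto simp: field_simps)
  with ne show ?thesis
    by (simp add: gns_frame_def gns_inner_def)
qed

lemma comult_c2_state:
  "comult c2_state u = 2 *\<^sub>C ((u * c2_e1) \<otimes>\<^sub>t c2_e1 + (u * c2_e2) \<otimes>\<^sub>t c2_e2)"
proof -
  have ne: "complex_of_real (sqrt 2) *\<^sub>C c2_e1 \<noteq> complex_of_real (sqrt 2) *\<^sub>C c2_e2"
    by transfer simp
  have sq: "complex_of_real (sqrt 2) * complex_of_real (sqrt 2) = 2"
    by (simp flip: of_real_mult)
  show ?thesis
    using comult_mult[OF faithful_c2_state frame_c2_state, of u 1] ne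
    by (simp add: star_scaleC mult_scaleC_right cbilinear_simps[OF cbilinear_tensor_pure]
        scaleC_scaleC sq scaleC_add_right)
qed

lemma delta_c2_state: "delta c2_state = sqrt 2"
proof (rule delta_eqI)
  show "delta_form c2_state (sqrt 2)"
    unfolding delta_form_def comult_c2_state
    by (simp add: clinear_simps[OF clinear_mult_map] mult_map_pure mult.assoc c2_e_sum
        flip: distrib_left)
qed

text \<open>The factors \<open>2\<close> from the comultiplication and \<open>\<delta>\<^sup>2 = 2\<close> cancel, so in the basis of minimal
  projections this is the entrywise product of matrices.\<close>

lemma schur_product_c2:
  assumes "clinear S" "clinear T"
  shows "schur_product c2_state S T u = S (u * c2_e1) * T c2_e1 + S (u * c2_e2) * T c2_e2"
  by (simp add: schur_product_def comult_c2_state delta_c2_state clinear_simps[OF clinear_tensor_map]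
      clinear_simps[OF clinear_mult_map] tensor_map_pure[OF assms] mult_map_pure scaleC_scaleC
      scaleC_one scaleC_add_right del: complex_vector.scale_left_commute)

lemma schur_product_c2_id_iff:
  assumes M: "clinear M"
  shows "schur_product c2_state id M = M \<longleftrightarrow>
    snd (of_c2 (M c2_e1)) = 0 \<and> fst (of_c2 (M c2_e2)) = 0"
proof -
  have id: "clinear (id :: c2 \<Rightarrow> c2)" by (simp add: clinear_iff)
  have "schur_product c2_state id M = M \<longleftrightarrow> c2_e1 * M c2_e1 = M c2_e1 \<and> c2_e2 * M c2_e2 = M c2_e2"
  proof
    assume "schur_product c2_state id M = M"
    from fun_cong[OF this] show "c2_e1 * M c2_e1 = M c2_e1 \<and> c2_e2 * M c2_e2 = M c2_e2"
      unfolding schur_product_c2[OF id M] by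
        (metis add_0 add_0_right c2_e_simps(1-4) id_apply mult_zero_left)
  next
    assume *: "c2_e1 * M c2_e1 = M c2_e1 \<and> c2_e2 * M c2_e2 = M c2_e2"
    show "schur_product c2_state id M = M"
    proof
      fix u
      show "schur_product c2_state id M u = M u"
        using c2_decomp[of u] *
        by (metis (no_types, lifting) schur_product_c2[OF id M] c2_mult_e clinear_simps(1,2)[OF M]
            id_apply mult_scaleC_left)
    qed
  qed
  then show ?thesis by (simp add: c2_mult_e_eq_iff)
qed

lemma schur_product_c2_swap_iff:
  assumes M: "clinear M"
  shows "schur_product c2_state c2_swap M = M \<longleftrightarrow>
    fst (of_c2 (M c2_e1)) = 0 \<and> snd (of_c2 (M c2_e2)) = 0"
proof -
  note sw = clinear_simps[OF clinear_c2_swap]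
  have "schur_product c2_state c2_swap M = M \<longleftrightarrow> c2_e2 * M c2_e1 = M c2_e1 \<and> c2_e1 * M c2_e2 = M c2_e2"
  proof
    assume "schur_product c2_state c2_swap M = M"
    from fun_cong[OF this, of c2_e1] fun_cong[OF this, of c2_e2]
    show "c2_e2 * M c2_e1 = M c2_e1 \<and> c2_e1 * M c2_e2 = M c2_e2"
      unfolding schur_product_c2[OF clinear_c2_swap M] by (simp add: sw)
  next
    assume *: "c2_e2 * M c2_e1 = M c2_e1 \<and> c2_e1 * M c2_e2 = M c2_e2"
    show "schur_product c2_state c2_swap M = M"
    proof
      fix u
      have "M u = M (fst (of_c2 u) *\<^sub>C c2_e1 + snd (of_c2 u) *\<^sub>C c2_e2)"
        using c2_decomp[of u] by simp
      then show "schur_product c2_state c2_swap M u = M u"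
        using * by (simp add: schur_product_c2[OF clinear_c2_swap M] c2_mult_e clinear_simps[OF M] sw
            mult_scaleC_left)
    qed
  qed
  then show ?thesis by (simp add: c2_mult_e_eq_iff)
qed

lemma adj_c2:
  assumes \<psi>: "clinear \<psi>" and f: "unital_star_hom f"
  shows "adj c2_state \<psi> f y = to_c2 (2 * \<psi> (f c2_e1 * y), 2 * \<psi> (f c2_e2 * y))"
proof -
  have lin: "clinear f" using f by (simp add: unital_star_hom_def)
  have "adj c2_state \<psi> f = (\<lambda>y. to_c2 (2 * \<psi> (f c2_e1 * y), 2 * \<psi> (f c2_e2 * y)))"
  proof (rule adj_eqI[OF gns_nondegenerate_frame[OF frame_c2_state]])
    fix u y
    have "f u = f (fst (of_c2 u) *\<^sub>C c2_e1 + snd (of_c2 u) *\<^sub>C c2_e2)"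
      using c2_decomp[of u] by simp
    also have "\<dots> = fst (of_c2 u) *\<^sub>C f c2_e1 + snd (of_c2 u) *\<^sub>C f c2_e2"
      by (simp add: clinear_simps[OF lin])
    finally have fu: "f u = fst (of_c2 u) *\<^sub>C f c2_e1 + snd (of_c2 u) *\<^sub>C f c2_e2" .
    have sa: "(f c2_e1)\<^sup>\<star> = f c2_e1" "(f c2_e2)\<^sup>\<star> = f c2_e2"
      using f unfolding unital_star_hom_def by (metis c2_e_simps(5,6))+
    have "gns_inner \<psi> (f u) y =
        cnj (fst (of_c2 u)) * \<psi> (f c2_e1 * y) + cnj (snd (of_c2 u)) * \<psi> (f c2_e2 * y)"
      by (simp add: gns_inner_def fu star_simps sa distrib_right mult_scaleC_left
          clinear_simps[OF \<psi>] scaleC_complex_def)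
    also have "\<dots> = gns_inner c2_state u (to_c2 (2 * \<psi> (f c2_e1 * y), 2 * \<psi> (f c2_e2 * y)))"
      unfolding gns_inner_def by transfer (auto simp: field_simps)
    finally show "gns_inner \<psi> (f u) y =
        gns_inner c2_state u (to_c2 (2 * \<psi> (f c2_e1 * y), 2 * \<psi> (f c2_e2 * y)))" .
  qed
  then show ?thesis by simp
qed

lemma clinear_adj_c2:
  assumes \<psi>: "clinear \<psi>" and f: "unital_star_hom f" and A: "clinear A"
  shows "clinear (adj c2_state \<psi> f \<circ> A \<circ> f)"
  using f
  by (auto simp: clinear_iff adj_c2[OF \<psi> f] unital_star_hom_def clinear_simps[OF A]
      clinear_simps[OF \<psi>] distrib_left mult_scaleC_right scaleC_complex_def to_c2_inverse
      plus_c2.abs_eq scaleC_c2.abs_eq intro!: c2_eqI)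

text \<open>The matrix of \<open>f\<^sup>\<dagger> A f\<close> has the entries \<open>2 \<psi>(f(e\<^sub>i) A(f(e\<^sub>j)))\<close>. The Schur product with the
  identity deletes the off-diagonal entries, the Schur product with the swap deletes the diagonal.\<close>

lemma graph_hom_T2_iff:
  assumes \<psi>: "clinear \<psi>" and A: "clinear A"
  shows "graph_hom \<psi> A c2_state id f \<longleftrightarrow> unital_star_hom f \<and>
    \<psi> (f c2_e2 * A (f c2_e1)) = 0 \<and> \<psi> (f c2_e1 * A (f c2_e2)) = 0"
  using schur_product_c2_id_iff[OF clinear_adj_c2[OF \<psi> _ A]]
  by (auto simp: graph_hom_def adj_c2[OF \<psi>] to_c2_inverse)

lemma graph_hom_K2_iff:
  assumes \<psi>: "clinear \<psi>" and A: "clinear A"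
  shows "graph_hom \<psi> A c2_state c2_swap f \<longleftrightarrow> unital_star_hom f \<and>
    \<psi> (f c2_e1 * A (f c2_e1)) = 0 \<and> \<psi> (f c2_e2 * A (f c2_e2)) = 0"
  using schur_product_c2_swap_iff[OF clinear_adj_c2[OF \<psi> _ A]]
  by (auto simp: graph_hom_def adj_c2[OF \<psi>] to_c2_inverse)

definition nontrivial_projection :: "'a::star_algebra \<Rightarrow> bool" where
  "nontrivial_projection p \<longleftrightarrow> p\<^sup>\<star> = p \<and> p * p = p \<and> p \<noteq> 0 \<and> p \<noteq> 1"

text \<open>\<open>f\<close> corresponds to \<open>p = f(e\<^sub>1)\<close>; injectivity says that both \<open>p\<close> and \<open>1 - p\<close> are nonzero.\<close>

lemma ex_injective_hom_c2_iff:
  fixes P :: "'a::star_algebra \<Rightarrow> 'a \<Rightarrow> bool"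
  shows "(\<exists>f. unital_star_hom f \<and> inj f \<and> P (f c2_e1) (f c2_e2)) \<longleftrightarrow>
    (\<exists>p. nontrivial_projection p \<and> P p (1 - p))"
proof
  assume "\<exists>f. unital_star_hom f \<and> inj f \<and> P (f c2_e1) (f c2_e2)"
  then obtain f where f: "unital_star_hom f" "inj f" "P (f c2_e1) (f c2_e2)" by blast
  have lin: "clinear f" "f 1 = 1" using f(1) by (simp_all add: unital_star_hom_def)
  have "f c2_e1 \<noteq> f 0" "f c2_e1 \<noteq> f 1"
    using f(2) by (simp_all add: inj_eq)
  moreover have "(f c2_e1)\<^sup>\<star> = f c2_e1" "f c2_e1 * f c2_e1 = f c2_e1"
    using f(1) unfolding unital_star_hom_def by (metis c2_e_simps(1,5))+
  moreover have "f c2_e2 = 1 - f c2_e1"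
    by (simp add: c2_e2_eq clinear_diff[OF lin(1)] lin(2))
  ultimately show "\<exists>p. nontrivial_projection p \<and> P p (1 - p)"
    using f(3) lin by (intro exI[of _ "f c2_e1"]) (simp add: nontrivial_projection_def clinear_simps)
next
  assume "\<exists>p. nontrivial_projection p \<and> P p (1 - p)"
  then obtain p where p: "p\<^sup>\<star> = p" "p * p = p" "p \<noteq> 0" "p \<noteq> 1" "P p (1 - p)"
    by (auto simp: nontrivial_projection_def)
  define f where "f u = fst (of_c2 u) *\<^sub>C p + snd (of_c2 u) *\<^sub>C (1 - p)" for u
  have pq: "p * (1 - p) = 0" "(1 - p) * p = 0" "(1 - p) * (1 - p) = 1 - p"
    using p(2) by (simp_all add: algebra_simps)
  have of_simps: "of_c2 1 = (1, 1)" "of_c2 c2_e1 = (1, 0)" "of_c2 c2_e2 = (0, 1)"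
    "fst (of_c2 (u + v)) = fst (of_c2 u) + fst (of_c2 v)"
    "snd (of_c2 (u + v)) = snd (of_c2 u) + snd (of_c2 v)"
    "fst (of_c2 (u * v)) = fst (of_c2 u) * fst (of_c2 v)"
    "snd (of_c2 (u * v)) = snd (of_c2 u) * snd (of_c2 v)"
    "fst (of_c2 (a *\<^sub>C u)) = a * fst (of_c2 u)" "snd (of_c2 (a *\<^sub>C u)) = a * snd (of_c2 u)"
    "fst (of_c2 (u\<^sup>\<star>)) = cnj (fst (of_c2 u))" "snd (of_c2 (u\<^sup>\<star>)) = cnj (snd (of_c2 u))"
    for u v a
    by (transfer; auto)+
  have "unital_star_hom f"
    unfolding unital_star_hom_def clinear_iff
  proof (intro conjI allI)
    show "f 1 = 1" by (simp add: f_def of_simps scaleC_one)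
    show "f (x + y) = f x + f y" for x y by (simp add: f_def of_simps scaleC_add_left)
    show "f (a *\<^sub>C x) = a *\<^sub>C f x" for a x
      by (simp add: f_def of_simps scaleC_add_right scaleC_scaleC)
    show "f (x * y) = f x * f y" for x y
      by (simp add: f_def of_simps distrib_left distrib_right mult_scaleC_left mult_scaleC_right
          scaleC_scaleC pq p(2) mult.commute)
    show "f (x\<^sup>\<star>) = (f x)\<^sup>\<star>" for x
      by (simp add: f_def of_simps star_simps p(1))
  qed
  moreover have "inj f"
  proof (rule injI)
    fix u v assume eq: "f u = f v"
    have "f w * p = fst (of_c2 w) *\<^sub>C p" "f w * (1 - p) = snd (of_c2 w) *\<^sub>C (1 - p)" for w
      unfolding f_def distrib_right mult_scaleC_left by (simp_all add: pq p(2))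
    then have "fst (of_c2 u) *\<^sub>C p = fst (of_c2 v) *\<^sub>C p"
      "snd (of_c2 u) *\<^sub>C (1 - p) = snd (of_c2 v) *\<^sub>C (1 - p)"
      using eq by metis+
    then show "u = v"
      using p(3,4) by (intro c2_eqI) auto
  qed
  moreover have "f c2_e1 = p" "f c2_e2 = 1 - p"
    by (simp_all add: f_def of_simps scaleC_one)
  ultimately show "\<exists>f. unital_star_hom f \<and> inj f \<and> P (f c2_e1) (f c2_e2)"
    using p(5) by (intro exI[of _ f]) simp
qed

section \<open>Projections in the algebra generated by a self-adjoint element\<close>

text \<open>The coefficients are complex while the argument lies in an algebra that need not be
  commutative, so this is not an instance of \<^const>\<open>poly\<close>.\<close>

definition poly_at :: "complex poly \<Rightarrow> 'a::star_algebra \<Rightarrow> 'a" where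
  "poly_at p h = fold_coeffs (\<lambda>a y. a *\<^sub>C 1 + h * y) p 0"

lemma poly_at_0 [simp]: "poly_at 0 h = 0"
  by (simp add: poly_at_def)

lemma poly_at_pCons [simp]: "poly_at (pCons a p) h = a *\<^sub>C 1 + h * poly_at p h"
  by (cases "p = 0 \<and> a = 0") (auto simp: poly_at_def)

lemma poly_at_add: "poly_at (p + q) h = poly_at p h + poly_at q h"
  by (induction p q rule: poly_induct2) (simp_all add: scaleC_add_left distrib_left)

lemma poly_at_sum: "poly_at (\<Sum>i\<in>I. p i) h = (\<Sum>i\<in>I. poly_at (p i) h)"
  by (induction I rule: infinite_finite_induct) (simp_all add: poly_at_add)

lemma poly_at_smult: "poly_at (smult c p) h = c *\<^sub>C poly_at p h"
  by (induction p) (simp_all add: scaleC_add_right scaleC_scaleC mult_scaleC_right)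

lemma poly_at_monom: "poly_at (monom a n) h = a *\<^sub>C h ^ n"
  by (induction n) (simp_all add: monom_0 monom_Suc mult_scaleC_right)

text \<open>In finite dimension the powers of \<open>h\<close> either repeat or are linearly dependent.\<close>

lemma ex_annihilating_poly:
  fixes h :: "'a::fd_cstar_algebra"
  shows "\<exists>p. p \<noteq> 0 \<and> poly_at p h = 0"
proof (cases "inj (\<lambda>n. h ^ n)")
  case False
  then obtain i j where ij: "i \<noteq> j" "h ^ i = h ^ j" by (auto simp: inj_on_def)
  define p where "p = monom (1 :: complex) i + monom (- 1) j"
  have "coeff p i \<noteq> 0" using ij(1) by (simp add: p_def)
  then have "p \<noteq> 0" by auto
  moreover have "poly_at p h = 0"
    by (simp add: p_def poly_at_add poly_at_monom ij(2) flip: scaleC_add_left)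
  ultimately show ?thesis by blast
next
  case True
  obtain S :: "'a set" where S: "finite S" "complex_vector.span S = UNIV"
    by (rule finite_spanning_set)
  have "infinite (range (\<lambda>n. h ^ n))"
    using True finite_imageD by auto
  then have "complex_vector.dependent (range (\<lambda>n. h ^ n))"
    using complex_vector.independent_span_bound[OF S(1), of "range (\<lambda>n. h ^ n)"] S(2) by blast
  then obtain T u where T: "finite T" "T \<subseteq> range (\<lambda>n. h ^ n)" "(\<Sum>v\<in>T. u v *\<^sub>C v) = 0"
    "\<exists>v\<in>T. u v \<noteq> 0"
    unfolding complex_vector.dependent_explicit by blast
  obtain I where I: "finite I" "T = (\<lambda>n. h ^ n) ` I"
    using T(1,2) by (meson finite_subset_image)
  define p where "p = (\<Sum>i\<in>I. monom (u (h ^ i)) i)"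
  obtain i where i: "i \<in> I" "u (h ^ i) \<noteq> 0" using T(4) I(2) by auto
  have "coeff p i = u (h ^ i)"
    using i(1) I(1) by (simp add: p_def coeff_sum sum.delta)
  then have "p \<noteq> 0" using i(2) by auto
  moreover have "poly_at p h = 0"
    using T(3) by (simp add: p_def poly_at_sum poly_at_monom I(2) sum.reindex inj_on_subset[OF True])
  ultimately show ?thesis by blast
qed

lemma poly_at_eigenvector:
  assumes "h * u = l *\<^sub>C u"
  shows "poly_at p h * u = poly p l *\<^sub>C u"
  by (induction p) (simp_all add: distrib_right mult_scaleC_left mult_scaleC_right mult.assoc assms
      scaleC_add_left scaleC_scaleC mult.commute)

lemma poly_at_eigenvector':
  assumes "u * h = l *\<^sub>C u"
  shows "u * poly_at p h = poly p l *\<^sub>C u"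
  by (induction p) (simp_all add: distrib_left mult_scaleC_left mult_scaleC_right assms
      scaleC_add_left scaleC_scaleC flip: mult.assoc)

lemma poly_at_commute: "poly_at p h * h = h * poly_at p h"
  by (induction p) (simp_all add: distrib_left distrib_right mult_scaleC_left mult_scaleC_right
      mult.assoc)

text \<open>Divide a minimal polynomial of \<open>h\<close> by a linear factor \<open>X - l\<close>: the quotient does not annihilate
  \<open>h\<close>, but \<open>h - l\<close> times it does.\<close>

lemma ex_poly_eigenvector:
  fixes h :: "'a::fd_cstar_algebra"
  obtains r l where "poly_at r h \<noteq> 0" "h * poly_at r h = l *\<^sub>C poly_at r h"
proof -
  define P where "P p \<longleftrightarrow> p \<noteq> 0 \<and> poly_at p h = 0" for p
  obtain p where p: "P p" "\<And>q. P q \<Longrightarrow> degree p \<le> degree q"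
    using ex_annihilating_poly[of h] ex_has_least_nat[of P _ degree] unfolding P_def by metis
  have "degree p > 0"
  proof (rule ccontr)
    assume "\<not> degree p > 0"
    then obtain a where "p = [:a:]" by (auto elim: degree_eq_zeroE)
    then show False using p(1) by (simp add: P_def)
  qed
  then obtain l where "poly p l = 0"
    using alg_closed_imp_poly_has_root by blast
  then obtain r where r: "p = [:- l, 1:] * r" by (auto simp: poly_eq_0_iff_dvd elim: dvdE)
  have "r \<noteq> 0" using r p(1) by (auto simp: P_def)
  then have "degree p = Suc (degree r)" by (subst r, subst degree_mult_eq) auto
  then have "poly_at r h \<noteq> 0" using p(2)[of r] \<open>r \<noteq> 0\<close> by (auto simp: P_def)
  moreover have "h * poly_at r h = l *\<^sub>C poly_at r h"
  proof -
    have "pCons 0 r = p + smult l r" by (simp add: r)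
    from arg_cong[OF this, of "\<lambda>q. poly_at q h"] p(1) show ?thesis
      by (simp add: P_def poly_at_add poly_at_smult)
  qed
  ultimately show ?thesis using that by blast
qed

text \<open>Let \<open>w\<close> be an eigenvector of \<open>h\<close> that is a polynomial in \<open>h\<close>. Then \<open>u = w\<^sup>\<star> w\<close> is also an
  eigenvector, the eigenvalue is real because \<open>u\<close> and \<open>h\<close> are self-adjoint, and polynomials in \<open>h\<close>
  act on \<open>u\<close> as scalars. In particular \<open>u\<^sup>2\<close> is a multiple of \<open>u\<close>, so \<open>u\<close> is proportional to a
  projection. That projection is not \<open>1\<close>, as otherwise \<open>h\<close> would be a scalar. The explicit form
  of the projection records that it is built from \<open>h\<close>.\<close>

lemma ex_nontrivial_projection:
  fixes h :: "'a::fd_cstar_algebra" and \<psi> :: "'a \<Rightarrow> complex"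
  assumes \<psi>: "faithful_state \<psi>" and h: "h\<^sup>\<star> = h" "\<nexists>c. h = c *\<^sub>C 1"
  obtains c r where "nontrivial_projection (c *\<^sub>C ((poly_at r h)\<^sup>\<star> * poly_at r h))"
proof -
  obtain r l where r: "poly_at r h \<noteq> 0" "h * poly_at r h = l *\<^sub>C poly_at r h"
    using ex_poly_eigenvector .
  define w where "w = poly_at r h"
  define u where "u = w\<^sup>\<star> * w"
  have psi0: "\<psi> 0 = 0" by (rule clinear_simps(3)[OF state_linear[OF \<psi>]])
  have w: "w \<noteq> 0" "w * h = l *\<^sub>C w"
    using r by (simp_all add: w_def poly_at_commute)
  have u0: "u \<noteq> 0"
    using w(1) state_eq_0[OF \<psi>, of w] psi0 by (auto simp: u_def)
  have u_star: "u\<^sup>\<star> = u" by (simp add: u_def star_simps)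
  have uh: "u * h = l *\<^sub>C u" by (simp add: u_def mult.assoc w(2) mult_scaleC_right)
  have "h * u = (u * h)\<^sup>\<star>" by (simp add: star_simps h(1) u_star)
  also have "\<dots> = cnj l *\<^sub>C u" by (simp add: uh star_simps u_star)
  finally have hu': "h * u = cnj l *\<^sub>C u" .
  have "l *\<^sub>C (u * u) = u * h * u" by (simp add: uh mult_scaleC_left)
  also have "\<dots> = cnj l *\<^sub>C (u * u)" by (simp add: mult.assoc hu' mult_scaleC_right)
  finally have l: "l *\<^sub>C (u * u) = cnj l *\<^sub>C (u * u)" .
  have uu: "u * u \<noteq> 0"
    using u0 state_eq_0[OF \<psi>, of u] psi0 by (auto simp: u_star)
  with l have "cnj l = l" by (simp add: complex_vector.scale_right_imp_eq)
  with hu' have hu: "h * u = l *\<^sub>C u" by simp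
  define k where "k = poly r l"
  have wu: "w * u = k *\<^sub>C u" "u * w = k *\<^sub>C u"
    by (simp_all add: w_def k_def poly_at_eigenvector[OF hu] poly_at_eigenvector'[OF uh])
  have "w\<^sup>\<star> * u = (u * w)\<^sup>\<star>" by (simp add: star_simps u_star)
  then have w'u: "w\<^sup>\<star> * u = cnj k *\<^sub>C u" by (simp add: wu(2) star_simps u_star)
  have "u * u = w\<^sup>\<star> * (w * u)" by (simp add: u_def mult.assoc)
  also have "\<dots> = (k * cnj k) *\<^sub>C u" by (simp add: wu(1) mult_scaleC_right w'u scaleC_scaleC)
  finally have u2: "u * u = (k * cnj k) *\<^sub>C u" .
  define m where "m = k * cnj k"
  have m: "u * u = m *\<^sub>C u" "cnj m = m" by (simp_all add: u2 m_def mult.commute)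
  with uu have m0: "m \<noteq> 0" by auto
  define e where "e = inverse m *\<^sub>C u"
  have "e * e = e"
    using m0 by (simp add: e_def mult_scaleC_left mult_scaleC_right m(1) scaleC_scaleC)
  moreover have "e\<^sup>\<star> = e" by (simp add: e_def star_simps u_star m(2))
  moreover have "e \<noteq> 0" using u0 m0 by (simp add: e_def)
  moreover have "e \<noteq> 1"
  proof
    assume "e = 1"
    moreover have "h * e = l *\<^sub>C e"
      by (simp add: e_def mult_scaleC_right hu scaleC_scaleC mult.commute)
    ultimately show False using h(2) by simp
  qed
  ultimately have "nontrivial_projection e" by (simp add: nontrivial_projection_def)
  then show ?thesis using that[of "inverse m" r] by (simp add: e_def u_def w_def)
qed

section \<open>Regular tracial quantum graphs\<close>

locale tracial_regular_graph =
  fixes \<psi> :: "'b::fd_cstar_algebra \<Rightarrow> complex" and A :: "'b \<Rightarrow> 'b" and d :: complex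
  assumes quantum_graph: "quantum_graph \<psi> A"
    and undirected: "undirected_graph \<psi> A"
    and tracial: "tracial \<psi>"
    and regular: "regular_graph \<psi> A d"
begin

lemma state: "faithful_state \<psi>"
  using quantum_graph by (simp add: quantum_graph_def quantum_set_def)

lemma linear_A: "clinear A"
  using quantum_graph by (simp add: quantum_graph_def)

lemmas state_simps = clinear_simps[OF state_linear[OF state]] clinear_sum[OF state_linear[OF state]]
  clinear_diff[OF state_linear[OF state]] clinear_minus[OF state_linear[OF state]] scaleC_complex_def

lemmas A_simps = clinear_simps[OF linear_A] clinear_diff[OF linear_A] clinear_minus[OF linear_A]

lemma trace: "\<psi> (x * y) = \<psi> (y * x)"
  using tracial by (simp add: tracial_def)

lemma A_star: "A (x\<^sup>\<star>) = (A x)\<^sup>\<star>"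
  using undirected by (metis undirected_graph_def real_graph_def map_star_def star_star)

lemma A_one: "A 1 = d *\<^sub>C 1"
  using regular by (simp add: regular_graph_def)

lemma degree_real: "cnj d = d"
proof -
  have "cnj d *\<^sub>C (1 :: 'b) = d *\<^sub>C 1"
    using A_star[of 1] by (simp add: A_one star_scaleC)
  then show ?thesis by (simp add: complex_vector.scale_right_imp_eq)
qed

text \<open>\<open>A\<close> is self-adjoint and \<open>1\<close> is an eigenvector: \<open>\<langle>1|A y\<rangle> = \<langle>A 1|y\<rangle>\<close>.\<close>

lemma state_A: "\<psi> (A y) = d * \<psi> y"
proof -
  obtain E where "gns_frame \<psi> E" using ex_gns_frame[OF state] .
  from gns_inner_adj[OF state state_linear[OF state] this linear_A, of 1 y]
  show ?thesis
    using undirected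
    by (simp add: undirected_graph_def gns_inner_def A_one star_scaleC mult_scaleC_left
        state_simps degree_real)
qed

text \<open>The idempotence \<open>A \<bullet> A = A\<close>, written with the adjoint frame. Since \<open>A(x\<^sup>\<star> e\<^sup>\<star>) = A(e x)\<^sup>\<star>\<close>,
  taking \<open>x\<^sup>\<star>\<close> for \<open>x\<close> and \<open>x\<close> for \<open>y\<close> shows that \<open>A\<close> is positive.\<close>

lemma schur_idempotent:
  assumes "gns_frame \<psi> E"
  shows "(\<Sum>e\<in>E. A (x * e\<^sup>\<star>) * A (e * y)) = complex_of_real ((delta \<psi>)\<^sup>2) *\<^sub>C A (x * y)"
proof -
  have "inj_on star E" by (metis inj_onI star_star)
  moreover have "schur_product \<psi> A A = A"
    using quantum_graph by (simp add: quantum_graph_def)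
  ultimately have "A (x * y) =
      inverse (complex_of_real ((delta \<psi>)\<^sup>2)) *\<^sub>C (\<Sum>e\<in>E. A (x * e\<^sup>\<star>) * A (e * y))"
    using schur_product_mult[OF state frame_star[OF state tracial assms] linear_A linear_A, of x y]
    by (simp add: sum.reindex star_star)
  moreover have "delta \<psi> \<noteq> 0"
    using delta_pos[of \<psi>] quantum_graph by (auto simp: quantum_graph_def)
  ultimately show ?thesis by (simp add: scaleC_scaleC)
qed

text \<open>By \<open>schur_idempotent\<close> with \<open>x = y = q\<close>, \<open>\<delta>\<^sup>2 \<psi>(p A(q)) = \<delta>\<^sup>2 \<psi>(p A(q) p)\<close> is the sum of the
  squares \<open>\<psi>(|A(e q) p|\<^sup>2)\<close>.\<close>

lemma no_edges_imp_orthogonal: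
  assumes p: "p\<^sup>\<star> = p" "p * p = p" and q: "q\<^sup>\<star> = q" "q * q = q" and 0: "\<psi> (p * A q) = 0"
  shows "A (z * q) * p = 0"
proof -
  obtain E where E: "gns_frame \<psi> E" using ex_gns_frame[OF state] .
  have "(\<Sum>e\<in>E. \<psi> ((A (e * q) * p)\<^sup>\<star> * (A (e * q) * p))) =
      \<psi> (p * (\<Sum>e\<in>E. A (q * e\<^sup>\<star>) * A (e * q)) * p)"
    by (simp add: star_simps p(1) q(1) sum_distrib_left sum_distrib_right state_simps mult.assoc
        flip: A_star)
  also have "\<dots> = complex_of_real ((delta \<psi>)\<^sup>2) * \<psi> (p * A q * p)"
    by (simp add: schur_idempotent[OF E] q(2) mult_scaleC_left mult_scaleC_right state_simps)
  also have "\<psi> (p * A q * p) = 0"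
    using trace[of "p * A q" p] 0 by (simp add: p(2) flip: mult.assoc)
  finally have "A (e * q) * p = 0" if "e \<in> E" for e
    using that E sum_state_eq_0[OF state, of E "\<lambda>e. A (e * q) * p"] by (simp add: gns_frame_def)
  then show ?thesis
    by (rule frame_extensionality[OF E, where f = "\<lambda>z. A (z * q) * p", rotated])
      (simp_all add: clinear_iff distrib_right A_simps mult_scaleC_left)
qed

text \<open>Expanding \<open>|A(e x) + A(e) x|\<^sup>2\<close> and summing over the frame gives four instances of
  \<open>schur_idempotent\<close>. Under \<open>\<psi>\<close> they contribute \<open>d, - d, - d, d\<close> times \<open>\<delta>\<^sup>2 \<psi>(x\<^sup>2)\<close> and cancel. For a
  classical graph the expression is a multiple of the sum of \<open>|x\<^sub>u + x\<^sub>v|\<^sup>2\<close> over the edges \<open>u v\<close>.\<close>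

lemma antisymmetric_eigenvector:
  assumes x: "x\<^sup>\<star> = x" "A x = - d *\<^sub>C x"
  shows "A (z * x) = - (A z * x)"
proof -
  obtain E where E: "gns_frame \<psi> E" using ex_gns_frame[OF state] .
  let ?\<delta> = "complex_of_real ((delta \<psi>)\<^sup>2)"
  note S = schur_idempotent[OF E]
  have "(\<Sum>e\<in>E. \<psi> ((A (e * x) + A e * x)\<^sup>\<star> * (A (e * x) + A e * x))) =
      \<psi> ((\<Sum>e\<in>E. A (x * e\<^sup>\<star>) * A (e * x)) + (\<Sum>e\<in>E. A (x * e\<^sup>\<star>) * A (e * 1)) * x
        + x * (\<Sum>e\<in>E. A (1 * e\<^sup>\<star>) * A (e * x)) + x * (\<Sum>e\<in>E. A (1 * e\<^sup>\<star>) * A (e * 1)) * x)"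
    by (simp add: star_simps x(1) sum_distrib_left sum_distrib_right state_simps mult.assoc
        distrib_left distrib_right sum.distrib flip: A_star)
  also have "\<dots> = 0"
    unfolding S
    by (simp add: state_simps state_A mult_scaleC_left mult_scaleC_right x(2) A_one)
  finally have "A (e * x) + A e * x = 0" if "e \<in> E" for e
    using that E sum_state_eq_0[OF state, of E "\<lambda>e. A (e * x) + A e * x"] by (simp add: gns_frame_def)
  then have "A (z * x) + A z * x = 0"
    by (rule frame_extensionality[OF E, where f = "\<lambda>z. A (z * x) + A z * x", rotated])
      (simp_all add: clinear_iff distrib_right A_simps mult_scaleC_left scaleC_add_right)
  then show ?thesis by (simp add: eq_neg_iff_add_eq_0)
qed

lemma connected_iff:
  "connected_graph \<psi> A \<longleftrightarrow>
    \<not> (\<exists>p. nontrivial_projection p \<and> \<psi> ((1 - p) * A p) = 0 \<and> \<psi> (p * A (1 - p)) = 0)"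
  using ex_injective_hom_c2_iff[of "\<lambda>p q. \<psi> (q * A p) = 0 \<and> \<psi> (p * A q) = 0"]
  unfolding connected_graph_def surjective_graph_hom_def
    graph_hom_T2_iff[OF state_linear[OF state] linear_A] by blast

lemma bipartite_iff:
  "bipartite_graph \<psi> A \<longleftrightarrow>
    (\<exists>p. nontrivial_projection p \<and> \<psi> (p * A p) = 0 \<and> \<psi> ((1 - p) * A (1 - p)) = 0)"
  using ex_injective_hom_c2_iff[of "\<lambda>p q. \<psi> (p * A p) = 0 \<and> \<psi> (q * A q) = 0"]
  unfolding bipartite_graph_def surjective_graph_hom_def
    graph_hom_K2_iff[OF state_linear[OF state] linear_A] by blast

lemma poly_at_multiplicative:
  assumes "\<And>z. A (z * h) = A z * h"
  shows "A (z * poly_at r h) = A z * poly_at r h"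
  by (induction r arbitrary: z)
    (simp_all add: distrib_left A_simps mult_scaleC_right assms flip: mult.assoc)

text \<open>The condition on \<open>h\<close> passes to polynomials \<open>w\<close> in \<open>h\<close>, whence \<open>A(w\<^sup>\<star> w) = A(w)\<^sup>\<star> w = d w\<^sup>\<star> w\<close>. So the
  projection \<open>p\<close> from \<open>ex_nontrivial_projection\<close> satisfies \<open>A(p) = d p\<close>, and no edges leave it.\<close>

lemma connected_imp_scalar:
  assumes conn: "connected_graph \<psi> A" and h: "h\<^sup>\<star> = h" "\<And>z. A (z * h) = A z * h"
  shows "\<exists>c. h = c *\<^sub>C 1"
proof (rule ccontr)
  assume "\<nexists>c. h = c *\<^sub>C 1"
  then obtain c r where p: "nontrivial_projection (c *\<^sub>C ((poly_at r h)\<^sup>\<star> * poly_at r h))"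
    using ex_nontrivial_projection[OF state h(1)] by blast
  define w p where "w = poly_at r h" and "p = c *\<^sub>C (w\<^sup>\<star> * w)"
  have Aw: "A (z * w) = A z * w" for z
    unfolding w_def by (rule poly_at_multiplicative[OF h(2)])
  have "A w = d *\<^sub>C w"
    using Aw[of 1] by (simp add: A_one mult_scaleC_left)
  then have Ap: "A p = d *\<^sub>C p"
    by (simp add: p_def A_simps Aw A_star star_scaleC degree_real mult_scaleC_left scaleC_scaleC
        mult.commute)
  have proj: "nontrivial_projection p" using p by (simp add: p_def w_def)
  have "(1 - p) * p = 0" "p * (1 - p) = 0"
    using proj by (simp_all add: nontrivial_projection_def algebra_simps)
  then have "\<psi> ((1 - p) * A p) = 0" "\<psi> (p * A (1 - p)) = 0"
    by (simp_all add: Ap A_simps A_one mult_scaleC_right state_simps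
        flip: complex_vector.scale_right_diff_distrib)
  with conn proj show False by (auto simp: connected_iff)
qed

text \<open>\<open>\<psi>(A(1)) = 0\<close>, to which \<open>no_edges_imp_orthogonal\<close> applies with \<open>p = q = 1\<close>.\<close>

lemma degree_zero_imp_A_zero:
  assumes "d = 0"
  shows "A z = 0"
  using no_edges_imp_orthogonal[of 1 1 z] by (simp add: A_one assms state_simps)

lemma connected_degree_zero_imp_dim_le_1:
  assumes conn: "connected_graph \<psi> A" and "d = 0"
  shows "cdim (UNIV :: 'b set) \<le> 1"
proof -
  have sa: "\<exists>c. h = c *\<^sub>C 1" if "h\<^sup>\<star> = h" for h :: 'b
    by (rule connected_imp_scalar[OF conn that]) (simp add: degree_zero_imp_A_zero[OF \<open>d = 0\<close>])
  have "x \<in> complex_vector.span {1}" for x :: 'b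
  proof -
    \<comment> \<open>As \<open>A = 0\<close>, every self-adjoint element is a scalar, hence so are the real and imaginary parts.\<close>
    obtain a b where "x + x\<^sup>\<star> = a *\<^sub>C 1" "\<i> *\<^sub>C (x - x\<^sup>\<star>) = b *\<^sub>C 1"
      using sa[of "x + x\<^sup>\<star>"] sa[of "\<i> *\<^sub>C (x - x\<^sup>\<star>)"]
      by (auto simp: star_simps add.commute complex_vector.scale_right_diff_distrib)
    then have ab: "(x + x\<^sup>\<star>) - \<i> *\<^sub>C \<i> *\<^sub>C (x - x\<^sup>\<star>) = (a - \<i> * b) *\<^sub>C 1"
      by (simp only: scaleC_scaleC complex_vector.scale_left_diff_distrib)
    have "x = (1 / 2) *\<^sub>C ((x + x\<^sup>\<star>) - \<i> *\<^sub>C \<i> *\<^sub>C (x - x\<^sup>\<star>))"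
      by (simp add: scaleC_scaleC scaleC_add_right complex_vector.scale_right_diff_distrib scaleC_one
          flip: scaleC_add_left)
    also have "\<dots> = ((a - \<i> * b) / 2) *\<^sub>C 1"
      unfolding ab by (simp add: scaleC_scaleC)
    finally show ?thesis
      by (metis complex_vector.span_scale complex_vector.span_base singletonI)
  qed
  then show ?thesis
    using complex_vector.dim_le_card[of UNIV "{1 :: 'b}"] by auto
qed

text \<open>No edges inside the parts means \<open>A(p) p = 0 = A(q) q\<close>, so \<open>A(p) = A(p) q = A(1) q = d q\<close>.\<close>

lemma bipartite_imp_eigenvector:
  assumes "bipartite_graph \<psi> A"
  shows "\<exists>x. x \<noteq> 0 \<and> A x = - d *\<^sub>C x"
proof -
  obtain p where p: "nontrivial_projection p" "\<psi> (p * A p) = 0" "\<psi> ((1 - p) * A (1 - p)) = 0"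
    using assms by (auto simp: bipartite_iff)
  have proj: "p\<^sup>\<star> = p" "p * p = p" "(1 - p)\<^sup>\<star> = 1 - p" "(1 - p) * (1 - p) = 1 - p"
    using p(1) by (simp_all add: nontrivial_projection_def star_simps algebra_simps)
  have 0: "A p * p = 0" "A (1 - p) * (1 - p) = 0"
    using no_edges_imp_orthogonal[OF proj(1,2,1,2) p(2), of 1]
      no_edges_imp_orthogonal[OF proj(3,4,3,4) p(3), of 1] by simp_all
  have "A p = A p * (1 - p) + A (1 - p) * (1 - p)"
    using 0 by (simp add: right_diff_distrib)
  also have "\<dots> = A (p + (1 - p)) * (1 - p)"
    by (simp only: A_simps distrib_right)
  finally have "A p = d *\<^sub>C (1 - p)"
    by (simp add: A_one mult_scaleC_left)
  then have "A (p - (1 - p)) = - d *\<^sub>C (p - (1 - p))"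
    by (simp add: A_simps A_one complex_vector.scale_right_diff_distrib)
  moreover have "p - (1 - p) \<noteq> 0"
  proof
    assume "p - (1 - p) = 0"
    \<comment> \<open>The left side is \<open>p - p\<^sup>2 = 0\<close> and the right side is \<open>p\<close>.\<close>
    then have "p * (1 - p) = p * p" by simp
    then show False using p(1) by (simp add: nontrivial_projection_def algebra_simps)
  qed
  ultimately show ?thesis by blast
qed

text \<open>The eigenvector is replaced by a self-adjoint one, whose square is a positive scalar by
  connectedness; normalised, it is the difference of the two parts.\<close>

lemma connected_eigenvector_imp_bipartite:
  assumes conn: "connected_graph \<psi> A" and d: "d \<noteq> 0" and y: "y \<noteq> 0" "A y = - d *\<^sub>C y"
  shows "bipartite_graph \<psi> A"
proof -
  have Ays: "A (y\<^sup>\<star>) = - d *\<^sub>C y\<^sup>\<star>"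
    by (simp add: A_star y(2) star_simps degree_real)
  obtain x where x: "x \<noteq> 0" "x\<^sup>\<star> = x" "A x = - d *\<^sub>C x"
  proof (cases "y + y\<^sup>\<star> = 0")
    case False
    then show ?thesis
      using y(2) Ays by (intro that[of "y + y\<^sup>\<star>"])
        (simp_all add: star_simps A_simps scaleC_add_right add.commute)
  next
    case True
    \<comment> \<open>\<open>y\<close> is skew-adjoint, so \<open>\<i> y\<close> is self-adjoint.\<close>
    then have "y\<^sup>\<star> = - y" by (simp add: eq_neg_iff_add_eq_0 add.commute)
    then show ?thesis
      using y by (intro that[of "\<i> *\<^sub>C y"])
        (simp_all add: star_simps A_simps scaleC_scaleC mult.commute)
  qed
  have anti: "A (z * x) = - (A z * x)" for z
    by (rule antisymmetric_eigenvector[OF x(2,3)])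
  have "A (z * (x * x)) = A z * (x * x)" for z
    using anti[of "z * x"] by (simp add: anti mult.assoc)
  then obtain c where c: "x * x = c *\<^sub>C 1"
    using connected_imp_scalar[OF conn, of "x * x"] by (auto simp: star_simps x(2))
  have "\<psi> (x\<^sup>\<star> * x) = c"
    using state by (simp add: x(2) c state_simps faithful_state_def)
  then obtain k where k: "c = complex_of_real k" "k > 0"
    using state_nonneg[OF state, of x] state_eq_0[OF state, of x] x(1)
    by (intro that[of "Re c"]) (auto simp: complex_eq_iff less_le)
  define s where "s = complex_of_real (inverse (sqrt k)) *\<^sub>C x"
  have s: "s\<^sup>\<star> = s" "A s = - d *\<^sub>C s"
    by (simp_all add: s_def star_simps x(2,3) A_simps scaleC_scaleC mult.commute)
  have "inverse (sqrt k) * (inverse (sqrt k) * k) = 1"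
    using k(2) by (simp add: field_simps)
  then have ss: "s * s = 1"
    by (simp add: s_def mult_scaleC_left mult_scaleC_right c scaleC_scaleC k(1) scaleC_one
        flip: of_real_mult of_real_inverse)
  define p where "p = (1 / 2) *\<^sub>C (1 + s)"
  have q: "1 - p = (1 / 2) *\<^sub>C (1 - s)"
    by (simp add: p_def algebra_simps scaleC_add_right complex_vector.scale_right_diff_distrib
        flip: scaleC_add_left)
  have "(1 + s) * (1 + s) = 2 *\<^sub>C (1 + s)"
    using scaleC_add_left[of 1 1 "1 + s"]
    by (simp add: distrib_left distrib_right ss scaleC_one add_ac)
  then have pp: "p * p = p"
    by (simp add: p_def mult_scaleC_left mult_scaleC_right scaleC_scaleC)
  have Ap: "A p = d *\<^sub>C (1 - p)"
    by (simp add: q, simp add: p_def A_simps A_one s scaleC_scaleC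
        complex_vector.scale_right_diff_distrib)
  have "A (1 - p) = d *\<^sub>C p"
    by (simp add: A_simps A_one Ap complex_vector.scale_right_diff_distrib)
  moreover have "p * (1 - p) = 0" "(1 - p) * p = 0"
    by (simp_all add: algebra_simps pp)
  ultimately have "\<psi> (p * A p) = 0" "\<psi> ((1 - p) * A (1 - p)) = 0"
    by (simp_all only: Ap mult_scaleC_right state_simps mult_zero_right)
  \<comment> \<open>A trivial \<open>p\<close> would turn \<open>A(p) = d (1 - p)\<close> into \<open>d = 0\<close>.\<close>
  moreover have "p \<noteq> 0" "p \<noteq> 1"
    using Ap d by (auto simp: A_simps A_one)
  moreover have "p\<^sup>\<star> = p"
    by (simp add: p_def star_simps s(1))
  ultimately show ?thesis
    unfolding bipartite_iff nontrivial_projection_def using pp by blast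
qed

end

section \<open>Spectrum and bipartiteness\<close>

text \<open>On a finite-dimensional space an injective endomorphism is bijective.\<close>

lemma op_spectrum_iff_eigenvector:
  fixes T :: "'a::fd_cstar_algebra \<Rightarrow> 'a"
  assumes "clinear T"
  shows "c \<in> op_spectrum T \<longleftrightarrow> (\<exists>x. x \<noteq> 0 \<and> T x = c *\<^sub>C x)"
proof -
  let ?S = "\<lambda>x. T x - c *\<^sub>C x"
  have S: "clinear ?S"
    unfolding clinear_iff
  proof (intro conjI allI)
    fix x y a
    show "?S (x + y) = ?S x + ?S y"
      by (simp only: clinear_simps(1)[OF assms] scaleC_add_right add_diff_add)
    show "?S (a *\<^sub>C x) = a *\<^sub>C ?S x"
      by (simp only: clinear_simps(2)[OF assms] complex_vector.scale_right_diff_distrib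
          complex_vector.scale_left_commute)
  qed
  obtain F :: "'a set" where F: "finite F" "complex_vector.span F = UNIV"
    by (rule finite_spanning_set)
  obtain B :: "'a set" where B: "complex_vector.independent B" "UNIV \<subseteq> complex_vector.span B"
    by (rule complex_vector.maximal_independent_subset[of UNIV])
  have "finite B"
    using complex_vector.independent_span_bound[OF F(1) B(1)] F(2) by blast
  then interpret finite_dimensional_vector_space "scaleC :: complex \<Rightarrow> 'a \<Rightarrow> 'a" B
    using B by unfold_locales auto
  have "bij ?S \<longleftrightarrow> inj ?S"
    using linear_inj_imp_surj[OF S] by (auto simp: bij_def)
  also have "\<dots> \<longleftrightarrow> (\<forall>x. ?S x = 0 \<longrightarrow> x = 0)"
    using clinear_diff[OF S] clinear_simps(3)[OF S] unfolding inj_def by (metis eq_iff_diff_eq_0)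
  finally show ?thesis by (auto simp: op_spectrum_def)
qed

theorem theorem3p8:
  fixes \<psi> :: "'b::fd_cstar_algebra \<Rightarrow> complex" and A :: "'b \<Rightarrow> 'b" and d :: complex
  assumes "quantum_graph \<psi> A"
    and "undirected_graph \<psi> A"
    and "tracial \<psi>"
    and "regular_graph \<psi> A d"
    and "connected_graph \<psi> A"
  shows "(bipartite_graph \<psi> A \<longleftrightarrow>
           - d \<in> op_spectrum A \<and> (d = 0 \<longrightarrow> op_multiplicity A 0 \<ge> 2)) \<and>
         (d = 0 \<longrightarrow> (op_multiplicity A 0 \<ge> 2 \<longleftrightarrow> cdim (UNIV :: 'b set) \<ge> 2))"
proof -
  interpret tracial_regular_graph \<psi> A d
    by unfold_locales (use assms in auto)
  show ?thesis
  proof (cases "d = 0")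
    case False
    then show ?thesis
      using bipartite_imp_eigenvector connected_eigenvector_imp_bipartite[OF assms(5)]
      by (auto simp: op_spectrum_iff_eigenvector[OF linear_A])
  next
    case True
    have A0: "A x = 0" for x by (rule degree_zero_imp_A_zero[OF True])
    have "\<not> bipartite_graph \<psi> A"
      using assms(5) unfolding bipartite_iff connected_iff A0 by blast
    moreover have "op_multiplicity A 0 = cdim (UNIV :: 'b set)"
      by (simp add: op_multiplicity_def A0)
    ultimately show ?thesis
      using connected_degree_zero_imp_dim_le_1[OF assms(5) True] True by simp
  qed
qed

end
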